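(* Let $\mathcal O_1$ and $\mathcal O_2$ be binary symmetric operads over a field $\mathbb K$ with finite-dimensional components, and put $x_m=\dim\mathcal O_1(m)$, $y_m=\dim\mathcal O_2(m)$. Let $\mathcal T=\mathcal T(\mathcal O_1,\mathcal O_2)$ with its decomposition $\mathcal T(n)=\mathcal T(n)^\bullet\oplus\mathcal T(n)^\circ$ ($n\ge2$) be as described in the context, and put $d_n^\bullet=\dim\mathcal T(n)^\bullet$, $d_n^\circ=\dim\mathcal T(n)^\circ$. Then $$d_3^\bullet=x_3+3x_2y_2,$$ $$d_4^\bullet=x_4+6x_3y_2+3x_2y_2^2+4x_2y_3+12x_2^2y_2,$$ $$d_5^\bullet=x_5+10x_4y_2+5x_2y_4+15x_3y_2^2+30x_2^2y_3+50x_2x_3y_2+10x_2y_2y_3+90x_2^2y_2^2+15x_2^3y_2+10x_3y_3,$$ and $d_n^\circ$ for $n=3,4,5$ is obtained from the formula for $d_n^\bullet$ by interchanging $x$ and $y$, i.e. by replacing $x_m$ with $y_m$ and $y_m$ with $x_m$ for all $m$.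
   Context: A symmetric operad $\mathcal P$ is a collection of $S_n$-modules $\mathcal P(n)$, $n\ge1$, with associative, equivariant, unital composition maps. An operad is binary if it is generated by its component of arity $2$ (so its component of arity $1$ is $\mathbb K\,\mathrm{id}$). Construction of the $S_n$-modules $\mathcal T(n)$. Put $\mathcal T(1)=\mathbb K\,\mathrm{id}$, with the convention $\mathcal T(1)^\bullet=\mathcal T(1)^\circ=\mathcal T(1)$. Put $\mathcal T(2)=\mathcal T(2)^\bullet\oplus\mathcal T(2)^\circ$ with $\mathcal T(2)^\bullet=\mathcal O_1(2)$, $\mathcal T(2)^\circ=\mathcal O_2(2)$. For $n>2$, let $P(n)$ be the set of partitions $\lambda=(n_1,\dots,n_m)$ of $n$, $n_1\ge\dots\ge n_m\ge1$, with $m\ge2$ parts, and set $$\mathcal T_\lambda(n)^\bullet=\mathcal O_1(m)\otimes\mathcal T(n_1)^\circ\otimes\cdots\otimes\mathcal T(n_m)^\circ,\qquad \mathcal T_\lambda(n)^\circ=\mathcal O_2(m)\otimes\mathcal T(n_1)^\bullet\otimes\cdots\otimes\mathcal T(n_m)^\bullet .$$ Let $S(m,\lambda)=\{\sigma\in S_m: n_{\sigma(i)}=n_i \text{ for all } i\}$, and let $S(\lambda)\subseteq S_n$ be the subgroup generated by $S_{n_1}\times\dots\times S_{n_m}$ (acting inside consecutive blocks of sizes $n_1,\dots,n_m$) and by $S(m,\lambda)$ (permuting blocks of equal size); it has order $|S(m,\lambda)|\,n_1!\cdots n_m!$ and acts in the obvious way on $\mathcal T_\lambda(n)^\bullet$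 and $\mathcal T_\lambda(n)^\circ$ (block permutations act on $\mathcal O_i(m)$ and permute the tensor factors). Define $$\mathcal T(n)^\bullet=\bigoplus_{\lambda\in P(n)}\mathrm{Ind}_{S(\lambda)}^{S_n}\mathcal T_\lambda(n)^\bullet,\quad \mathcal T(n)^\circ=\bigoplus_{\lambda\in P(n)}\mathrm{Ind}_{S(\lambda)}^{S_n}\mathcal T_\lambda(n)^\circ,\quad \mathcal T(n)=\mathcal T(n)^\bullet\oplus\mathcal T(n)^\circ .$$ The collection $\mathcal T(n)$, $n\ge 1$, carries an operad structure isomorphic to the free product (coproduct in the category of symmetric operads) $\mathcal O_1\ast\mathcal O_2$. *)

theory Defs
  imports
    Complex_Main
    "HOL-Library.FuncSet"
    "HOL-Library.Poly_Mapping"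
    "HOL-Combinatorics.Permutations"
    "HOL-Algebra.Generated_Groups"
    "HOL-Algebra.Left_Coset"
begin

text \<open>
  Positions and blocks are numbered from 0, so \<open>S_n\<close> consists of the permutations of \<open>{..<n}\<close>.
  A \<open>K\<close>-module is a subspace of an ambient vector space (a type with a scalar multiplication
  satisfying \<^locale>\<open>vector_space\<close>), so that \<open>vector_space.dim\<close> is its dimension.
\<close>

section \<open>Symmetric groups and their block subgroups\<close>

definition Sym :: "nat \<Rightarrow> (nat \<Rightarrow> nat) monoid" where
  "Sym n = \<lparr>carrier = {p. p permutes {..<n}}, mult = (\<circ>), one = id\<rparr>"

text \<open>
  A list \<open>ns\<close> cuts \<open>{..<sum_list ns}\<close> into consecutive blocks of sizes \<open>ns ! 0, ns ! 1, \<dots>\<close>.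
  Position \<open>p\<close> is the entry \<open>in_block ns p\<close> of the block \<open>block_of ns p\<close>.
\<close>

definition offset :: "nat list \<Rightarrow> nat \<Rightarrow> nat" where
  "offset ns i = sum_list (take i ns)"

definition block_of :: "nat list \<Rightarrow> nat \<Rightarrow> nat" where
  "block_of ns p = (LEAST i. p < offset ns (Suc i))"

definition in_block :: "nat list \<Rightarrow> nat \<Rightarrow> nat" where
  "in_block ns p = p - offset ns (block_of ns p)"

text \<open>The element \<open>(\<tau>\<^sub>0, \<dots>, \<tau>\<^sub>m\<^sub>-\<^sub>1)\<close> of the product of symmetric groups, acting inside the blocks.\<close>

definition sum_perm :: "nat list \<Rightarrow> (nat \<Rightarrow> nat) list \<Rightarrow> nat \<Rightarrow> nat" where
  "sum_perm ns \<tau>s p =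
     (if p < sum_list ns
      then offset ns (block_of ns p) + (\<tau>s ! block_of ns p) (in_block ns p) else p)"

text \<open>
  The block permutation of \<open>\<sigma>\<close>: the \<open>i\<close>-th block of the rearranged composition
  \<open>(n\<^sub>\<sigma>\<^sub>(\<^sub>0\<^sub>), n\<^sub>\<sigma>\<^sub>(\<^sub>1\<^sub>), \<dots>)\<close> is carried, in order, onto the block \<open>\<sigma> i\<close> of \<open>ns\<close>.
\<close>

definition block_perm :: "nat list \<Rightarrow> (nat \<Rightarrow> nat) \<Rightarrow> nat \<Rightarrow> nat" where
  "block_perm ns \<sigma> p =
     (if p < sum_list ns
      then offset ns (\<sigma> (block_of (permute_list \<sigma> ns) p)) + in_block (permute_list \<sigma> ns) p
      else p)"

definition inner_perms :: "nat list \<Rightarrow> (nat \<Rightarrow> nat) list set" where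
  "inner_perms ns = listset (map (\<lambda>k. {\<tau>. \<tau> permutes {..<k}}) ns)"

definition partitions :: "nat \<Rightarrow> nat list set" where
  "partitions n =
     {ns. sorted_wrt (\<ge>) ns \<and> 0 \<notin> set ns \<and> sum_list ns = n \<and> 2 \<le> length ns}"

definition part_symmetries :: "nat list \<Rightarrow> (nat \<Rightarrow> nat) set" where
  "part_symmetries ns =
     {\<sigma>. \<sigma> permutes {..<length ns} \<and> (\<forall>i<length ns. ns ! \<sigma> i = ns ! i)}"

definition S_lambda :: "nat list \<Rightarrow> (nat \<Rightarrow> nat) set" where
  "S_lambda ns =
     generate (Sym (sum_list ns))
       (sum_perm ns ` inner_perms ns \<union> block_perm ns ` part_symmetries ns)"


section \<open>Linear algebra on subspaces\<close>

definition linear_on_set ::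
  "('k \<Rightarrow> 'a::ab_group_add \<Rightarrow> 'a) \<Rightarrow> ('k \<Rightarrow> 'b::ab_group_add \<Rightarrow> 'b) \<Rightarrow> 'a set \<Rightarrow> ('a \<Rightarrow> 'b) \<Rightarrow> bool"
  where
  "linear_on_set s s' V f \<longleftrightarrow>
     (\<forall>v\<in>V. \<forall>w\<in>V. f (v + w) = f v + f w) \<and> (\<forall>c. \<forall>v\<in>V. f (s c v) = s' c (f v))"

definition multilinear_on ::
  "('k \<Rightarrow> 'a::ab_group_add \<Rightarrow> 'a) \<Rightarrow> ('k \<Rightarrow> 'b::ab_group_add \<Rightarrow> 'b) \<Rightarrow> ('k \<Rightarrow> 'c::ab_group_add \<Rightarrow> 'c)
     \<Rightarrow> 'a set \<Rightarrow> 'b set list \<Rightarrow> ('a \<Rightarrow> 'b list \<Rightarrow> 'c) \<Rightarrow> bool"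
  where
  "multilinear_on s s' s'' V Us f \<longleftrightarrow>
     (\<forall>us\<in>listset Us. linear_on_set s s'' V (\<lambda>v. f v us)) \<and>
     (\<forall>v\<in>V. \<forall>us\<in>listset Us. \<forall>i<length Us.
        linear_on_set s' s'' (Us ! i) (\<lambda>u. f v (us[i := u])))"

text \<open>
  \<open>direct_sum_on I M V\<close>: for finite \<open>I\<close> and subspaces \<open>M i\<close>, the space \<open>V\<close> is the internal direct
  sum of the \<open>M i\<close>.
\<close>

definition direct_sum_on :: "'i set \<Rightarrow> ('i \<Rightarrow> 'a::ab_group_add set) \<Rightarrow> 'a set \<Rightarrow> bool" where
  "direct_sum_on I M V \<longleftrightarrow> bij_betw (\<lambda>m. \<Sum>i\<in>I. m i) (Pi\<^sub>E I M) V"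

text \<open>
  The tensor product of \<open>V\<close> with the spaces listed in \<open>Us\<close> is the free vector space on the tuples
  \<open>(v, u\<^sub>0, \<dots>, u\<^sub>m\<^sub>-\<^sub>1)\<close> modulo the multilinearity relations.
  \<open>is_tensor_product \<dots> W t\<close> says that sending \<open>(v, us)\<close> to \<open>t v us\<close> induces an isomorphism
  from this quotient onto \<open>W\<close>.
\<close>

definition free_scale :: "'k::field \<Rightarrow> ('x \<Rightarrow>\<^sub>0 'k) \<Rightarrow> ('x \<Rightarrow>\<^sub>0 'k)" where
  "free_scale c f = Poly_Mapping.map ((*) c) f"

lemma lookup_free_scale: "Poly_Mapping.lookup (free_scale c f) x = c * Poly_Mapping.lookup f x"
  by (simp add: free_scale_def Poly_Mapping.map.rep_eq when_def)

lemma vector_space_free_scale: "vector_space free_scale"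
  by unfold_locales
    (auto intro!: poly_mapping_eqI simp: lookup_free_scale lookup_add algebra_simps)

definition tensor_relations ::
  "('k::field \<Rightarrow> 'a::ab_group_add \<Rightarrow> 'a) \<Rightarrow> ('k \<Rightarrow> 'b::ab_group_add \<Rightarrow> 'b)
     \<Rightarrow> 'a set \<Rightarrow> 'b set list \<Rightarrow> ('a \<times> 'b list \<Rightarrow>\<^sub>0 'k) set"
  where
  "tensor_relations s s' V Us =
     {Poly_Mapping.single (v + w, us) 1 - Poly_Mapping.single (v, us) 1
        - Poly_Mapping.single (w, us) 1
      | v w us. v \<in> V \<and> w \<in> V \<and> us \<in> listset Us} \<union>
     {Poly_Mapping.single (s c v, us) 1 - free_scale c (Poly_Mapping.single (v, us) 1)
      | c v us. v \<in> V \<and> us \<in> listset Us} \<union>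
     {Poly_Mapping.single (v, us[i := u + w]) 1 - Poly_Mapping.single (v, us[i := u]) 1
        - Poly_Mapping.single (v, us[i := w]) 1
      | v us i u w. v \<in> V \<and> us \<in> listset Us \<and> i < length Us \<and> u \<in> Us ! i \<and> w \<in> Us ! i} \<union>
     {Poly_Mapping.single (v, us[i := s' c u]) 1
        - free_scale c (Poly_Mapping.single (v, us[i := u]) 1)
      | v us i c u. v \<in> V \<and> us \<in> listset Us \<and> i < length Us \<and> u \<in> Us ! i}"

definition is_tensor_product ::
  "('k::field \<Rightarrow> 'a::ab_group_add \<Rightarrow> 'a) \<Rightarrow> ('k \<Rightarrow> 'b::ab_group_add \<Rightarrow> 'b)
     \<Rightarrow> ('k \<Rightarrow> 'c::ab_group_add \<Rightarrow> 'c)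
     \<Rightarrow> 'a set \<Rightarrow> 'b set list \<Rightarrow> 'c set \<Rightarrow> ('a \<Rightarrow> 'b list \<Rightarrow> 'c) \<Rightarrow> bool"
  where
  "is_tensor_product s s' s'' V Us W t \<longleftrightarrow>
     W = module.span s'' {t v us | v us. v \<in> V \<and> us \<in> listset Us} \<and>
     (\<forall>f :: 'a \<times> 'b list \<Rightarrow>\<^sub>0 'k. Poly_Mapping.keys f \<subseteq> V \<times> listset Us \<longrightarrow>
        ((\<Sum>(v, us)\<in>Poly_Mapping.keys f. s'' (Poly_Mapping.lookup f (v, us)) (t v us)) = 0
         \<longleftrightarrow> f \<in> module.span free_scale (tensor_relations s s' V Us)))"


section \<open>Modules over symmetric groups\<close>

definition Sym_module ::
  "('k::field \<Rightarrow> 'a::ab_group_add \<Rightarrow> 'a) \<Rightarrow> nat \<Rightarrow> 'a set \<Rightarrow> ((nat \<Rightarrow> nat) \<Rightarrow> 'a \<Rightarrow> 'a) \<Rightarrow> bool"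
  where
  "Sym_module s n V act \<longleftrightarrow>
     module.subspace s V \<and>
     (\<forall>\<sigma>\<in>carrier (Sym n). act \<sigma> \<in> V \<rightarrow> V \<and> linear_on_set s s V (act \<sigma>)) \<and>
     (\<forall>v\<in>V. act id v = v) \<and>
     (\<forall>\<sigma>\<in>carrier (Sym n). \<forall>\<tau>\<in>carrier (Sym n). \<forall>v\<in>V. act (\<sigma> \<circ> \<tau>) v = act \<sigma> (act \<tau> v))"

definition Sym_isomorphic ::
  "('k::field \<Rightarrow> 'a::ab_group_add \<Rightarrow> 'a) \<Rightarrow> ('k \<Rightarrow> 'b::ab_group_add \<Rightarrow> 'b) \<Rightarrow> nat
     \<Rightarrow> 'a set \<Rightarrow> ((nat \<Rightarrow> nat) \<Rightarrow> 'a \<Rightarrow> 'a) \<Rightarrow> 'b set \<Rightarrow> ((nat \<Rightarrow> nat) \<Rightarrow> 'b \<Rightarrow> 'b) \<Rightarrow> bool"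
  where
  "Sym_isomorphic s s' n V act V' act' \<longleftrightarrow>
     (\<exists>\<phi>. bij_betw \<phi> V V' \<and> linear_on_set s s' V \<phi> \<and>
          (\<forall>\<sigma>\<in>carrier (Sym n). \<forall>v\<in>V. \<phi> (act \<sigma> v) = act' \<sigma> (\<phi> v)))"

text \<open>
  \<open>is_induced n act H W M\<close>: inside a module of \<open>S_n\<close> with action \<open>act\<close>, the subspace \<open>M\<close> is the
  module induced from the \<open>H\<close>-stable subspace \<open>W\<close>, that is, \<open>M\<close> is the direct sum of the
  translates \<open>gW\<close> over the left cosets \<open>gH\<close>.
\<close>

definition is_induced ::
  "nat \<Rightarrow> ((nat \<Rightarrow> nat) \<Rightarrow> 'a::ab_group_add \<Rightarrow> 'a) \<Rightarrow> (nat \<Rightarrow> nat) set \<Rightarrow> 'a set \<Rightarrow> 'a set \<Rightarrow> bool"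
  where
  "is_induced n act H W M \<longleftrightarrow>
     (\<forall>h\<in>H. act h ` W \<subseteq> W) \<and>
     direct_sum_on (lcosets\<^bsub>Sym n\<^esub> H) (\<lambda>C. {act g w | g w. g \<in> C \<and> w \<in> W}) M"


section \<open>Symmetric operads\<close>

text \<open>
  \<open>compose P ns a bs\<close> is the composite of \<open>a\<close>, of arity \<open>length ns\<close>, with the operations \<open>bs ! i\<close>, of
  arities \<open>ns ! i\<close>; the arities are explicit because the components need not be disjoint.
\<close>

record ('k, 'a) operad =
  scl :: "'k \<Rightarrow> 'a \<Rightarrow> 'a"
  component :: "nat \<Rightarrow> 'a set"
  perm_act :: "nat \<Rightarrow> (nat \<Rightarrow> nat) \<Rightarrow> 'a \<Rightarrow> 'a"
  ident :: "'a"
  compose :: "nat list \<Rightarrow> 'a \<Rightarrow> 'a list \<Rightarrow> 'a"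

text \<open>
  Symmetric groups act on the left, as in \<open>(\<sigma> a)(x\<^sub>0, x\<^sub>1, \<dots>) = a(x\<^sub>\<sigma>\<^sub>(\<^sub>0\<^sub>), x\<^sub>\<sigma>\<^sub>(\<^sub>1\<^sub>), \<dots>)\<close> for
  multilinear operations; the equivariance axioms take the form that they have there.
\<close>

locale symmetric_operad =
  fixes P :: "('k::field, 'a::ab_group_add) operad"
  assumes ambient: "vector_space (scl P)"
    and comp_module: "n \<ge> 1 \<Longrightarrow> Sym_module (scl P) n (component P n) (perm_act P n)"
    and ident_mem: "ident P \<in> component P 1"
    and compose_mem:
      "\<lbrakk>ns \<noteq> []; 0 \<notin> set ns; a \<in> component P (length ns); bs \<in> listset (map (component P) ns)\<rbrakk>
       \<Longrightarrow> compose P ns a bs \<in> component P (sum_list ns)"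
    and compose_multilinear:
      "\<lbrakk>ns \<noteq> []; 0 \<notin> set ns\<rbrakk>
       \<Longrightarrow> multilinear_on (scl P) (scl P) (scl P) (component P (length ns)) (map (component P) ns)
             (compose P ns)"
    and compose_assoc:
      "\<lbrakk>kss \<noteq> []; [] \<notin> set kss; 0 \<notin> set (concat kss); a \<in> component P (length kss);
        bs \<in> listset (map (\<lambda>ks. component P (length ks)) kss);
        css \<in> listset (map (\<lambda>ks. listset (map (component P) ks)) kss)\<rbrakk>
       \<Longrightarrow> compose P (concat kss) (compose P (map length kss) a bs) (concat css)
         = compose P (map sum_list kss) a
             (map (\<lambda>i. compose P (kss ! i) (bs ! i) (css ! i)) [0..<length kss])"
    and ident_compose: "\<lbrakk>n \<ge> 1; a \<in> component P n\<rbrakk> \<Longrightarrow> compose P [n] (ident P) [a] = a"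
    and compose_ident:
      "\<lbrakk>n \<ge> 1; a \<in> component P n\<rbrakk> \<Longrightarrow> compose P (replicate n 1) a (replicate n (ident P)) = a"
    and inner_equivariant:
      "\<lbrakk>ns \<noteq> []; 0 \<notin> set ns; a \<in> component P (length ns); bs \<in> listset (map (component P) ns);
        \<tau>s \<in> inner_perms ns\<rbrakk>
       \<Longrightarrow> compose P ns a (map (\<lambda>i. perm_act P (ns ! i) (\<tau>s ! i) (bs ! i)) [0..<length ns])
         = perm_act P (sum_list ns) (sum_perm ns \<tau>s) (compose P ns a bs)"
    and outer_equivariant:
      "\<lbrakk>ns \<noteq> []; 0 \<notin> set ns; a \<in> component P (length ns); bs \<in> listset (map (component P) ns);
        \<sigma> permutes {..<length ns}\<rbrakk>
       \<Longrightarrow> compose P ns (perm_act P (length ns) \<sigma> a) bs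
         = perm_act P (sum_list ns) (block_perm ns \<sigma>)
             (compose P (permute_list \<sigma> ns) a (permute_list \<sigma> bs))"

definition suboperad :: "('k::field, 'a::ab_group_add) operad \<Rightarrow> (nat \<Rightarrow> 'a set) \<Rightarrow> bool" where
  "suboperad P Q \<longleftrightarrow>
     (\<forall>n\<ge>1. module.subspace (scl P) (Q n) \<and> Q n \<subseteq> component P n \<and>
        (\<forall>\<sigma>\<in>carrier (Sym n). perm_act P n \<sigma> ` Q n \<subseteq> Q n)) \<and>
     ident P \<in> Q 1 \<and>
     (\<forall>ns a bs. ns \<noteq> [] \<and> 0 \<notin> set ns \<and> a \<in> Q (length ns) \<and> bs \<in> listset (map Q ns) \<longrightarrow>
        compose P ns a bs \<in> Q (sum_list ns))"

definition binary :: "('k::field, 'a::ab_group_add) operad \<Rightarrow> bool" where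
  "binary P \<longleftrightarrow>
     (\<forall>Q. suboperad P Q \<and> component P 2 \<subseteq> Q 2 \<longrightarrow> (\<forall>n\<ge>1. Q n = component P n))"

definition finite_dim_comps :: "('k::field, 'a::ab_group_add) operad \<Rightarrow> bool" where
  "finite_dim_comps P \<longleftrightarrow> (\<forall>n\<ge>1. \<exists>B. finite B \<and> module.span (scl P) B = component P n)"


section \<open>The modules of the free product\<close>

text \<open>
  \<open>black T n\<close> and \<open>white T n\<close> are the submodules marked with a filled and with an empty circle, and
  \<open>whole T n\<close> is the module containing both.
\<close>

record ('k, 'c) bicolored =
  tscl :: "'k \<Rightarrow> 'c \<Rightarrow> 'c"
  whole :: "nat \<Rightarrow> 'c set"
  black :: "nat \<Rightarrow> 'c set"
  white :: "nat \<Rightarrow> 'c set"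
  tact :: "nat \<Rightarrow> (nat \<Rightarrow> nat) \<Rightarrow> 'c \<Rightarrow> 'c"
  tident :: "'c"

text \<open>
  \<open>root_sum T P U n X\<close>: the module \<open>X\<close> is the direct sum, over the partitions \<open>ns\<close> of \<open>n\<close> with at least
  two parts, of the modules induced from \<open>S_lambda ns\<close> by the tensor products of
  \<open>P(m)\<close> with \<open>U(n\<^sub>0), \<dots>, U(n\<^sub>m\<^sub>-\<^sub>1)\<close>, where \<open>m\<close> is the number of parts.  The last two conjuncts inside
  the quantifier over \<open>ns\<close> are the action of the generators of \<open>S_lambda ns\<close> on pure tensors.
\<close>

definition root_sum ::
  "('k::field, 'c::ab_group_add) bicolored \<Rightarrow> ('k, 'a::ab_group_add) operad
     \<Rightarrow> (nat \<Rightarrow> 'c set) \<Rightarrow> nat \<Rightarrow> 'c set \<Rightarrow> bool"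
  where
  "root_sum T P U n X \<longleftrightarrow>
     (\<exists>(M :: nat list \<Rightarrow> 'c set) (W :: nat list \<Rightarrow> 'c set) (t :: nat list \<Rightarrow> 'a \<Rightarrow> 'c list \<Rightarrow> 'c).
        direct_sum_on (partitions n) M X \<and>
        (\<forall>ns\<in>partitions n.
           is_induced n (tact T n) (S_lambda ns) (W ns) (M ns) \<and>
           is_tensor_product (scl P) (tscl T) (tscl T) (component P (length ns)) (map U ns)
             (W ns) (t ns) \<and>
           (\<forall>a\<in>component P (length ns). \<forall>us\<in>listset (map U ns). \<forall>\<tau>s\<in>inner_perms ns.
              tact T n (sum_perm ns \<tau>s) (t ns a us)
              = t ns a (map (\<lambda>i. tact T (ns ! i) (\<tau>s ! i) (us ! i)) [0..<length ns])) \<and>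
           (\<forall>a\<in>component P (length ns). \<forall>us\<in>listset (map U ns). \<forall>\<sigma>\<in>part_symmetries ns.
              tact T n (block_perm ns \<sigma>) (t ns a us)
              = t ns (perm_act P (length ns) \<sigma> a)
                  (permute_list (inv_into UNIV \<sigma>) us))))"

text \<open>
  The recursive construction determines \<open>T\<close> up to isomorphism; a structure satisfies the following
  locale if its modules are related to each other and to \<open>P\<close> and \<open>Q\<close> as in that construction.
\<close>

locale free_product_modules =
  fixes P :: "('k::field, 'a::ab_group_add) operad"
    and Q :: "('k, 'b::ab_group_add) operad"
    and T :: "('k, 'c::ab_group_add) bicolored"
  assumes t_ambient: "vector_space (tscl T)"
    and t_module: "n \<ge> 1 \<Longrightarrow> Sym_module (tscl T) n (whole T n) (tact T n)"
    and t_one: "tident T \<noteq> 0" "whole T 1 = module.span (tscl T) {tident T}"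
      "black T 1 = whole T 1" "white T 1 = whole T 1"
    and t_black: "n \<ge> 2 \<Longrightarrow> Sym_module (tscl T) n (black T n) (tact T n)"
    and t_white: "n \<ge> 2 \<Longrightarrow> Sym_module (tscl T) n (white T n) (tact T n)"
    and t_sum: "n \<ge> 2 \<Longrightarrow>
      direct_sum_on UNIV (\<lambda>c::bool. if c then black T n else white T n) (whole T n)"
    and t_two_black:
      "Sym_isomorphic (scl P) (tscl T) 2 (component P 2) (perm_act P 2) (black T 2) (tact T 2)"
    and t_two_white:
      "Sym_isomorphic (scl Q) (tscl T) 2 (component Q 2) (perm_act Q 2) (white T 2) (tact T 2)"
    and t_black_step: "n > 2 \<Longrightarrow> root_sum T P (white T) n (black T n)"
    and t_white_step: "n > 2 \<Longrightarrow> root_sum T Q (black T) n (white T n)"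

end

theory Submission
  imports Defs
begin

text \<open>
  For a partition \<open>\<lambda>\<close> of \<open>n\<close> into \<open>m\<close> parts, the summand of \<open>T(n)\<close> with black root has dimension
  \<open>[S_n : S(\<lambda>)] \<cdot> x_m \<cdot> d(n\<^sub>1) \<cdots> d(n\<^sub>m)\<close>, where \<open>d\<close> is the dimension of the white modules: dimensions
  multiply in tensor products, an induced module is a direct sum of as many isomorphic translates as
  there are cosets, and dimensions add in direct sums.  All parts are smaller than \<open>n\<close>, because there
  are at least two of them, so this is a recursion that computes the black and the white dimensions
  together, starting from \<open>d(1) = 1\<close> and the two operads in arity 2.  Listing the partitions of
  3, 4 and 5 and expanding gives the formulas.

  The modules are only known through the relations between them, so each of these three principles is
  proved from the corresponding characterization: \<open>has_dim_tensor_product\<close> from generators and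
  relations, \<open>has_dim_direct_sum\<close> from bijectivity of the summation map, and \<open>has_dim_induced\<close> from
  the decomposition into translates.

  The group \<open>S(\<lambda>)\<close> is given by generators, which does not reveal its order.  It is the stabilizer of
  the division of the positions into consecutive blocks (\<open>S_lambda_eq_stabilizer\<close>): a permutation that
  carries blocks to blocks induces a permutation of the set of blocks that respects their sizes, and
  dividing out the corresponding block permutation leaves a permutation inside the blocks.  Hence its
  order is the product of the factorials of the parts and of the multiplicities of the parts, and its
  index is the number of ways to divide an \<open>n\<close>-element set into subsets of sizes \<open>n\<^sub>1, \<dots>, n\<^sub>m\<close>.
\<close>

section \<open>Finite dimension\<close>

text \<open>
  The function \<open>dim\<close> is 0 on spaces without a finite basis, so equations between
  dimensions do not compose.  This relation carries finiteness along.
\<close>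

definition has_dim :: "('k::field \<Rightarrow> 'a::ab_group_add \<Rightarrow> 'a) \<Rightarrow> 'a set \<Rightarrow> nat \<Rightarrow> bool" where
  "has_dim s V d \<longleftrightarrow>
     (\<exists>B. finite B \<and> \<not> module.dependent s B \<and> module.span s B = V \<and> card B = d)"

context vector_space
begin

lemma has_dim_dim: "has_dim scale V d \<Longrightarrow> dim V = d"
  unfolding has_dim_def by (auto intro: dim_eq_card)

lemma has_dim_subspace: "has_dim scale V d \<Longrightarrow> subspace V"
  unfolding has_dim_def by auto

lemma has_dim_span_finite:
  assumes "finite B" "span B = V"
  shows "has_dim scale V (dim V)"
proof -
  obtain A where A: "A \<subseteq> V" "independent A" "V \<subseteq> span A"
    using maximal_independent_subset by blast
  have "finite A" using independent_span_bound[OF assms(1) A(2)] A(1) assms(2) by auto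
  moreover have "span A = V" using A assms by (metis span_minimal subset_antisym subspace_span)
  ultimately have "has_dim scale V (card A)" using A(2) unfolding has_dim_def by blast
  then show ?thesis using has_dim_dim by metis
qed

text \<open>
  Bases of direct sums and of tensor products are naturally indexed families of vectors rather than
  sets; injectivity of the family is a consequence of its linear independence.
\<close>

lemma has_dim_family:
  assumes "finite I" "subspace V" and mem: "\<And>i. i \<in> I \<Longrightarrow> e i \<in> V"
    and gen: "V \<subseteq> span (e ` I)"
    and ind: "\<And>c i. (\<Sum>i\<in>I. c i *s e i) = 0 \<Longrightarrow> i \<in> I \<Longrightarrow> c i = 0"
  shows "has_dim scale V (card I)"
proof -
  have inj: "inj_on e I"
  proof (rule inj_onI, rule ccontr)
    fix i j assume ij: "i \<in> I" "j \<in> I" "e i = e j" "i \<noteq> j"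
    \<comment> \<open>The dependence \<open>e i - e j = 0\<close> would have a nonzero coefficient.\<close>
    let ?c = "\<lambda>k. (if k = i then 1 else 0) - (if k = j then 1 else 0)"
    have "(\<Sum>k\<in>I. ?c k *s e k) = (\<Sum>k\<in>I. (if k = i then e k else 0)) - (\<Sum>k\<in>I. if k = j then e k else 0)"
      unfolding sum_subtractf[symmetric] by (rule sum.cong) (auto simp: scale_left_diff_distrib)
    also have "\<dots> = 0" using ij assms(1) by (simp add: sum.delta)
    finally show False using ind[of ?c i] ij by simp
  qed
  have "independent (e ` I)"
  proof (rule independent_if_scalars_zero)
    fix f x assume 0: "(\<Sum>x\<in>e ` I. f x *s x) = 0" and "x \<in> e ` I"
    then obtain i where i: "i \<in> I" "x = e i" by auto
    from 0 have "(\<Sum>i\<in>I. f (e i) *s e i) = 0" by (simp add: sum.reindex[OF inj])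
    from ind[OF this i(1)] show "f x = 0" using i by simp
  qed (use assms in auto)
  moreover have "span (e ` I) = V"
    using gen span_minimal[of "e ` I" V] mem assms(2) by blast
  ultimately show ?thesis unfolding has_dim_def using assms(1) card_image[OF inj] by blast
qed

end

lemma linear_on_set_sum:
  assumes "vector_space s" "vector_space s'" "linear_on_set s s' V f" "module.subspace s V"
    and "\<And>i. i \<in> I \<Longrightarrow> e i \<in> V"
  shows "f (\<Sum>i\<in>I. s (c i) (e i)) = (\<Sum>i\<in>I. s' (c i) (f (e i)))"
proof -
  interpret v: vector_space s by fact
  interpret w: vector_space s' by fact
  have 0: "f 0 = 0"
  proof -
    have "f (s 0 0) = s' 0 (f 0)"
      using assms(3,4) v.subspace_0 unfolding linear_on_set_def by blast
    then show ?thesis by simp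
  qed
  have "(\<Sum>i\<in>I. s (c i) (e i)) \<in> V \<and> f (\<Sum>i\<in>I. s (c i) (e i)) = (\<Sum>i\<in>I. s' (c i) (f (e i)))"
    using assms(5)
  proof (induction I rule: infinite_finite_induct)
    case (insert x F)
    then show ?case
      using assms(3,4) unfolding linear_on_set_def
      by (auto intro!: v.subspace_add v.subspace_scale simp: v.subspace_add v.subspace_scale)
  qed (use 0 assms(4) in \<open>auto intro: v.subspace_0\<close>)
  then show ?thesis ..
qed

lemma linear_on_set_zero:
  assumes "vector_space s" "vector_space s'" "linear_on_set s s' V f" "module.subspace s V"
  shows "f 0 = 0"
  using linear_on_set_sum[OF assms, of "{}"] by simp

lemma has_dim_linear_image:
  assumes "vector_space s" "vector_space s'" "linear_on_set s s' V f" "inj_on f V"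
    and "has_dim s V d"
  shows "has_dim s' (f ` V) d"
proof -
  interpret v: vector_space s by fact
  interpret w: vector_space s' by fact
  obtain B where B: "finite B" "v.independent B" "v.span B = V" "card B = d"
    using assms(5) unfolding has_dim_def by blast
  have sV: "v.subspace V" and BV: "B \<subseteq> V" using B v.span_superset by auto
  have lin: "f (\<Sum>b\<in>B. s (c b) b) = (\<Sum>b\<in>B. s' (c b) (f b))" for c
    by (rule linear_on_set_sum[OF assms(1,2,3) sV]) (use BV in auto)
  have VB: "V = range (\<lambda>u. \<Sum>v\<in>B. s (u v) v)" using v.span_finite[OF B(1)] B(3) by simp
  have "has_dim s' (f ` V) (card B)"
  proof (rule w.has_dim_family[where e = f])
    show "w.subspace (f ` V)"
      unfolding w.subspace_def
    proof safe
      show "0 \<in> f ` V" using linear_on_set_zero[OF assms(1-3) sV] v.subspace_0[OF sV] by force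
      fix x y c assume "x \<in> V" "y \<in> V"
      then have "f x + f y = f (x + y)" "s' c (f x) = f (s c x)" "x + y \<in> V" "s c x \<in> V"
        using assms(3) sV by (auto simp: linear_on_set_def v.subspace_def)
      then show "f x + f y \<in> f ` V" "s' c (f x) \<in> f ` V" by auto
    qed
    show "f ` V \<subseteq> w.span (f ` B)"
    proof
      fix w assume "w \<in> f ` V"
      then obtain u where "w = f (\<Sum>b\<in>B. s (u b) b)" using VB by blast
      then show "w \<in> w.span (f ` B)"
        unfolding lin by (auto intro: w.span_sum w.span_scale w.span_base)
    qed
    show "c b = 0" if 0: "(\<Sum>b\<in>B. s' (c b) (f b)) = 0" and b: "b \<in> B" for c b
    proof -
      have "f (\<Sum>b\<in>B. s (c b) b) = f 0"
        using 0 lin linear_on_set_zero[OF assms(1-3) sV] by simp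
      then have "(\<Sum>b\<in>B. s (c b) b) = 0"
        using inj_onD[OF assms(4)] VB v.subspace_0[OF sV] by blast
      then show ?thesis using B(1,2) b v.dependent_finite by blast
    qed
  qed (use B BV in auto)
  then show ?thesis using B(4) by simp
qed

text \<open>
  The zero vectors of the other summands complete a vector of \<open>M i\<close> to a family with that sum.
\<close>

lemma direct_sum_on_summand_subset:
  assumes "finite I" "direct_sum_on I M V" "\<And>i. i \<in> I \<Longrightarrow> 0 \<in> M i" "i \<in> I"
  shows "M i \<subseteq> V"
proof
  fix v assume v: "v \<in> M i"
  let ?m = "\<lambda>j\<in>I. if j = i then v else 0"
  have "?m \<in> Pi\<^sub>E I M" using v assms(3) by auto
  moreover have "(\<Sum>j\<in>I. ?m j) = v" using assms(1,4) by simp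
  ultimately show "v \<in> V" using bij_betwE assms(2) unfolding direct_sum_on_def by metis
qed

text \<open>
  The disjoint union of bases of the summands is a basis of the sum: bijectivity of the summation map
  makes it span and be independent.
\<close>

lemma (in vector_space) has_dim_direct_sum:
  assumes fin: "finite I" and sum: "direct_sum_on I M V"
    and M: "\<And>i. i \<in> I \<Longrightarrow> has_dim scale (M i) (d i)"
  shows "has_dim scale V (\<Sum>i\<in>I. d i)"
proof -
  have "\<forall>i\<in>I. \<exists>B. finite B \<and> independent B \<and> span B = M i \<and> card B = d i"
    using M unfolding has_dim_def by blast
  then obtain B where B: "\<And>i. i \<in> I \<Longrightarrow> finite (B i)" "\<And>i. i \<in> I \<Longrightarrow> independent (B i)"
      "\<And>i. i \<in> I \<Longrightarrow> span (B i) = M i" "\<And>i. i \<in> I \<Longrightarrow> card (B i) = d i"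
    by metis
  have bij: "bij_betw (\<lambda>m. \<Sum>i\<in>I. m i) (Pi\<^sub>E I M) V" using sum unfolding direct_sum_on_def .
  have sM: "subspace (M i)" if "i \<in> I" for i using M[OF that] by (rule has_dim_subspace)
  have M0: "0 \<in> M i" if "i \<in> I" for i using sM[OF that] by (rule subspace_0)
  note MV = direct_sum_on_summand_subset[OF fin sum M0]
  have inV: "(\<Sum>i\<in>I. m i) \<in> V" if "\<And>i. i \<in> I \<Longrightarrow> m i \<in> M i" for m
  proof -
    have "restrict m I \<in> Pi\<^sub>E I M" using that by auto
    from bij_betwE[OF bij, rule_format, OF this] show ?thesis by simp
  qed
  have exV: "\<exists>m\<in>Pi\<^sub>E I M. v = (\<Sum>i\<in>I. m i)" if "v \<in> V" for v
    using that bij_betw_imp_surj_on[OF bij] by blast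
  have sub: "subspace V"
    unfolding subspace_def
  proof (intro conjI ballI allI)
    show "0 \<in> V" using inV[of "\<lambda>_. 0"] M0 by simp
  next
    fix v w assume "v \<in> V" "w \<in> V"
    then obtain m m' where m: "m \<in> Pi\<^sub>E I M" "m' \<in> Pi\<^sub>E I M" "v = sum m I" "w = sum m' I"
      using exV by meson
    have "(\<Sum>i\<in>I. m i + m' i) \<in> V" using m sM by (intro inV subspace_add) auto
    then show "v + w \<in> V" using m by (simp add: sum.distrib)
  next
    fix c v assume "v \<in> V"
    then obtain m where m: "m \<in> Pi\<^sub>E I M" "v = sum m I" using exV by meson
    have "(\<Sum>i\<in>I. c *s m i) \<in> V" using m sM by (intro inV subspace_scale) auto
    then show "c *s v \<in> V" using m by (simp add: scale_sum_right)
  qed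
  have zero: "m i = 0" if m: "\<And>i. i \<in> I \<Longrightarrow> m i \<in> M i" and s: "(\<Sum>i\<in>I. m i) = 0" and i: "i \<in> I" for m i
  proof -
    have "restrict m I = restrict (\<lambda>_. 0) I"
      by (rule inj_onD[OF bij_betw_imp_inj_on[OF bij]]) (use m s M0 in auto)
    then show ?thesis using i by (metis restrict_apply')
  qed
  have "has_dim scale V (card (Sigma I B))"
  proof (rule has_dim_family[where e = snd])
    show "finite (Sigma I B)" using fin B(1) by auto
    show "snd x \<in> V" if "x \<in> Sigma I B" for x
      using that MV B(3) span_base by fastforce
    show "V \<subseteq> span (snd ` Sigma I B)"
    proof
      fix v assume "v \<in> V"
      then obtain m where m: "m \<in> Pi\<^sub>E I M" "v = (\<Sum>i\<in>I. m i)" using exV by meson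
      have "m i \<in> span (snd ` Sigma I B)" if i: "i \<in> I" for i
      proof -
        have "m i \<in> span (B i)" using m(1) B(3) i by auto
        moreover have "B i \<subseteq> snd ` Sigma I B" using i by force
        ultimately show ?thesis using span_mono by blast
      qed
      then show "v \<in> span (snd ` Sigma I B)" unfolding m(2) by (rule span_sum)
    qed
    show "c x = 0" if 0: "(\<Sum>x\<in>Sigma I B. c x *s snd x) = 0" and x: "x \<in> Sigma I B" for c x
    proof -
      obtain i b where ib: "x = (i, b)" "i \<in> I" "b \<in> B i" using x by auto
      have "(\<Sum>i\<in>I. \<Sum>b\<in>B i. c (i, b) *s b) = 0"
        using fin B(1) 0 by (subst sum.Sigma) (auto simp: case_prod_beta)
      then have "(\<Sum>b\<in>B i. c (i, b) *s b) = 0"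
      proof (rule zero[rotated])
        show "(\<Sum>b\<in>B j. c (j, b) *s b) \<in> M j" if "j \<in> I" for j
          unfolding B(3)[OF that, symmetric] by (intro span_sum span_scale span_base)
      qed fact
      from independentD[OF B(2)[OF ib(2)] B(1)[OF ib(2)] subset_refl this ib(3)]
      show ?thesis using ib(1) by simp
    qed
  qed (fact sub)
  then show ?thesis using fin B(1,4) by (simp add: card_SigmaI)
qed

section \<open>Dimension of a tensor product\<close>

lemma listset_iff_nth:
  "us \<in> listset Us \<longleftrightarrow> length us = length Us \<and> (\<forall>i<length Us. us ! i \<in> Us ! i)"
proof (induction Us arbitrary: us)
  case (Cons U Us)
  show ?case
  proof (cases us)
    case (Cons v vs)
    have "us \<in> listset (U # Us) \<longleftrightarrow> v \<in> U \<and> vs \<in> listset Us" by (simp add: set_Cons_def Cons)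
    then show ?thesis using Cons.IH[of vs] by (auto simp: Cons nth_Cons less_Suc_eq_0_disj)
  qed (simp add: set_Cons_def)
qed simp

lemma listset_update:
  "us \<in> listset Us \<Longrightarrow> u \<in> Us ! i \<Longrightarrow> us[i := u] \<in> listset Us"
  by (cases "i < length us") (auto simp: listset_iff_nth nth_list_update)

lemma card_listset: "card (listset As) = prod_list (map card As)"
proof (induction As)
  case (Cons A As)
  have "listset (A # As) = (\<lambda>(x, xs). x # xs) ` (A \<times> listset As)"
    by (auto simp: set_Cons_def)
  moreover have "inj_on (\<lambda>(x, xs). x # xs) (A \<times> listset As)" by (auto simp: inj_on_def)
  ultimately show ?case using Cons by (simp add: card_image card_cartesian_product)
qed simp

lemma finite_listset: "(\<And>A. A \<in> set As \<Longrightarrow> finite A) \<Longrightarrow> finite (listset As)"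
proof (induction As)
  case (Cons A As)
  have "listset (A # As) = (\<lambda>(x, xs). x # xs) ` (A \<times> listset As)"
    by (auto simp: set_Cons_def)
  then show ?case using Cons by simp
qed simp

text \<open>
  This is how formal combinations are evaluated in the kernel condition of a tensor product, and it also
  turns a multilinear functional on tuples into a linear functional on formal combinations.
\<close>

definition linear_extension ::
    "('k::field \<Rightarrow> 'c::ab_group_add \<Rightarrow> 'c) \<Rightarrow> ('x \<Rightarrow> 'c) \<Rightarrow> ('x \<Rightarrow>\<^sub>0 'k) \<Rightarrow> 'c" where
  "linear_extension s h f = (\<Sum>x\<in>Poly_Mapping.keys f. s (Poly_Mapping.lookup f x) (h x))"

context vector_space
begin

lemma linear_extension_superset:
  assumes "finite A" "Poly_Mapping.keys f \<subseteq> A"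
  shows "linear_extension scale h f = (\<Sum>x\<in>A. Poly_Mapping.lookup f x *s h x)"
  unfolding linear_extension_def using assms
  by (intro sum.mono_neutral_left) (auto simp: in_keys_iff)

lemma linear_extension_single [simp]: "linear_extension scale h (Poly_Mapping.single x c) = c *s h x"
  by (subst linear_extension_superset[of "{x}"]) auto

lemma linear_extension_add:
  "linear_extension scale h (f + g) = linear_extension scale h f + linear_extension scale h g"
proof -
  let ?A = "Poly_Mapping.keys f \<union> Poly_Mapping.keys g"
  have "Poly_Mapping.keys (f + g) \<subseteq> ?A" by (rule Poly_Mapping.keys_add)
  then show ?thesis
    by (simp add: linear_extension_superset[of ?A] lookup_add scale_left_distrib sum.distrib)
qed

lemma linear_extension_free_scale:
  "linear_extension scale h (free_scale c f) = c *s linear_extension scale h f"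
proof -
  have "Poly_Mapping.keys (free_scale c f) \<subseteq> Poly_Mapping.keys f"
    by (auto simp: in_keys_iff lookup_free_scale)
  then show ?thesis
    by (subst linear_extension_superset[of "Poly_Mapping.keys f"])
       (auto simp: lookup_free_scale linear_extension_def scale_sum_right)
qed

lemma linear_extension_diff:
  "linear_extension scale h (f - g) = linear_extension scale h f - linear_extension scale h g"
  using linear_extension_add[of h "f - g" g] by (simp add: algebra_simps)

lemma linear_extension_zero [simp]: "linear_extension scale h 0 = 0"
  by (simp add: linear_extension_def)

lemma linear_extension_vanishes_on_span:
  assumes "f \<in> module.span free_scale R" "\<And>r. r \<in> R \<Longrightarrow> linear_extension scale h r = 0"
  shows "linear_extension scale h f = 0"
proof -
  interpret F: vector_space "free_scale :: 'a \<Rightarrow> ('x \<Rightarrow>\<^sub>0 'a) \<Rightarrow> _" by (rule vector_space_free_scale)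
  show ?thesis
    using assms(1)
  proof (rule F.span_induct)
    show "F.subspace {f. linear_extension scale h f = 0}"
      by (auto simp: F.subspace_def linear_extension_add linear_extension_free_scale)
  qed (use assms(2) in auto)
qed

end

lemma vector_space_field: "vector_space ((*) :: 'k::field \<Rightarrow> 'k \<Rightarrow> 'k)"
  by unfold_locales (auto simp: algebra_simps)

lemma linear_extension_relation:
  fixes s :: "'k::field \<Rightarrow> 'a::ab_group_add \<Rightarrow> 'a" and s' :: "'k \<Rightarrow> 'b::ab_group_add \<Rightarrow> 'b"
    and s'' :: "'k \<Rightarrow> 'c::ab_group_add \<Rightarrow> 'c"
  assumes "vector_space s''" "multilinear_on s s' s'' V Us h"
    and "r \<in> tensor_relations s s' V Us"
  shows "linear_extension s'' (\<lambda>(v, us). h v us) r = 0"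
proof -
  interpret vector_space s'' by fact
  have m1: "h (v + w) us = h v us + h w us" "h (s c v) us = s'' c (h v us)"
    if "us \<in> listset Us" "v \<in> V" "w \<in> V" for us v w c
    using assms(2) that unfolding multilinear_on_def linear_on_set_def by blast+
  have m2: "h v (us[i := u + w]) = h v (us[i := u]) + h v (us[i := w])"
      "h v (us[i := s' c u]) = s'' c (h v (us[i := u]))"
    if "us \<in> listset Us" "v \<in> V" "i < length Us" "u \<in> Us ! i" "w \<in> Us ! i" for us v u w c i
    using assms(2) that unfolding multilinear_on_def linear_on_set_def by blast+
  from assms(3) show ?thesis
    unfolding tensor_relations_def
    by (auto simp: linear_extension_diff linear_extension_free_scale m1 m2)
qed

text \<open>
  The kernel condition of a tensor product only speaks of combinations supported on the tuples over the
  given spaces, so it applies to a relation once its support is known to consist of such tuples.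
\<close>

lemma keys_tensor_relation:
  fixes s :: "'k::field \<Rightarrow> 'a::ab_group_add \<Rightarrow> 'a" and s' :: "'k \<Rightarrow> 'b::ab_group_add \<Rightarrow> 'b"
  assumes "vector_space s" "vector_space s'" "module.subspace s V"
    and "\<And>U. U \<in> set Us \<Longrightarrow> module.subspace s' U"
    and "r \<in> tensor_relations s s' V Us"
  shows "Poly_Mapping.keys r \<subseteq> V \<times> listset Us"
proof -
  interpret v: vector_space s by fact
  interpret w: vector_space s' by fact
  have a: "Poly_Mapping.keys (p - q) \<subseteq> S" if "Poly_Mapping.keys p \<subseteq> S" "Poly_Mapping.keys q \<subseteq> S"
    for p q :: "'a \<times> 'b list \<Rightarrow>\<^sub>0 'k" and S
    using that by (metis (no_types, lifting) Un_subset_iff keys_diff subset_trans)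
  have b: "Poly_Mapping.keys (free_scale c p) \<subseteq> S" if "Poly_Mapping.keys p \<subseteq> S"
    for p :: "'a \<times> 'b list \<Rightarrow>\<^sub>0 'k" and S c
    using that by (auto simp: in_keys_iff lookup_free_scale)
  have c: "Poly_Mapping.keys (Poly_Mapping.single x (1::'k)) \<subseteq> S" if "x \<in> S" for x :: "'a \<times> 'b list" and S
    using that by simp
  have U: "w.subspace (Us ! i)" if "i < length Us" for i using assms(4) that by simp
  note [intro] = listset_update v.subspace_add[OF assms(3)] v.subspace_scale[OF assms(3)]
    w.subspace_add[OF U] w.subspace_scale[OF U]
  show ?thesis using assms(5)
    unfolding tensor_relations_def
    by (elim UnE CollectE exE conjE; hypsubst; intro a b c) auto
qed

lemma tensor_product_kernel:
  assumes "is_tensor_product s s' s'' V Us W t" "Poly_Mapping.keys f \<subseteq> V \<times> listset Us"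
  shows "linear_extension s'' (\<lambda>(v, us). t v us) f = 0 \<longleftrightarrow>
    f \<in> module.span free_scale (tensor_relations s s' V Us)"
  using assms unfolding is_tensor_product_def linear_extension_def
  by (simp add: case_prod_beta')

text \<open>
  Each defining relation lies in the span of the relations, hence evaluates to zero.
\<close>

lemma tensor_product_multilinear:
  fixes s :: "'k::field \<Rightarrow> 'a::ab_group_add \<Rightarrow> 'a" and s' :: "'k \<Rightarrow> 'b::ab_group_add \<Rightarrow> 'b"
    and s'' :: "'k \<Rightarrow> 'c::ab_group_add \<Rightarrow> 'c"
  assumes "vector_space s" "vector_space s'" "vector_space s''" "module.subspace s V"
    and "\<And>U. U \<in> set Us \<Longrightarrow> module.subspace s' U"
    and "is_tensor_product s s' s'' V Us W t"
  shows "multilinear_on s s' s'' V Us t"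
proof -
  interpret vector_space s'' by fact
  interpret F: vector_space "free_scale :: 'k \<Rightarrow> ('a \<times> 'b list \<Rightarrow>\<^sub>0 'k) \<Rightarrow> _"
    by (rule vector_space_free_scale)
  have R: "linear_extension s'' (\<lambda>(v, us). t v us) r = 0" if "r \<in> tensor_relations s s' V Us" for r
    using tensor_product_kernel[OF assms(6) keys_tensor_relation[OF assms(1,2,4,5) that]]
      F.span_base[OF that] by simp
  have m1: "t (v + w) us = t v us + t w us"
    if "us \<in> listset Us" "v \<in> V" "w \<in> V" for us v w
  proof -
    have "Poly_Mapping.single (v + w, us) 1 - Poly_Mapping.single (v, us) 1
        - Poly_Mapping.single (w, us) 1 \<in> tensor_relations s s' V Us"
      unfolding tensor_relations_def using that by blast
    from R[OF this] show ?thesis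
      by (simp add: linear_extension_diff linear_extension_add algebra_simps)
  qed
  have m2: "t (s c v) us = s'' c (t v us)"
    if "us \<in> listset Us" "v \<in> V" for us v c
  proof -
    have "Poly_Mapping.single (s c v, us) 1 - free_scale c (Poly_Mapping.single (v, us) 1)
        \<in> tensor_relations s s' V Us"
      unfolding tensor_relations_def using that by blast
    from R[OF this] show ?thesis by (simp add: linear_extension_diff linear_extension_free_scale)
  qed
  have m3: "t v (us[i := u + w]) = t v (us[i := u]) + t v (us[i := w])"
    if "us \<in> listset Us" "v \<in> V" "i < length Us" "u \<in> Us ! i" "w \<in> Us ! i" for us v u w i
  proof -
    have "Poly_Mapping.single (v, us[i := u + w]) 1 - Poly_Mapping.single (v, us[i := u]) 1
        - Poly_Mapping.single (v, us[i := w]) 1 \<in> tensor_relations s s' V Us"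
      unfolding tensor_relations_def using that by blast
    from R[OF this] show ?thesis
      by (simp add: linear_extension_diff linear_extension_add algebra_simps)
  qed
  have m4: "t v (us[i := s' c u]) = s'' c (t v (us[i := u]))"
    if "us \<in> listset Us" "v \<in> V" "i < length Us" "u \<in> Us ! i" for us v u c i
  proof -
    have "Poly_Mapping.single (v, us[i := s' c u]) 1
        - free_scale c (Poly_Mapping.single (v, us[i := u]) 1) \<in> tensor_relations s s' V Us"
      unfolding tensor_relations_def using that by blast
    from R[OF this] show ?thesis by (simp add: linear_extension_diff linear_extension_free_scale)
  qed
  show ?thesis unfolding multilinear_on_def linear_on_set_def
    using m1 m2 m3 m4 by simp
qed

text \<open>
  The pure tensors of basis vectors form a basis.  They span because every pure tensor can be expanded
  in one slot at a time.  They are independent because, for each choice of basis vectors, the product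
  of the corresponding coordinate functionals is multilinear, so its linear extension kills the
  tensor relations; on a vanishing combination of basis tensors it returns one coefficient.
\<close>

lemma has_dim_tensor_product:
  fixes s :: "'k::field \<Rightarrow> 'a::ab_group_add \<Rightarrow> 'a" and s' :: "'k \<Rightarrow> 'b::ab_group_add \<Rightarrow> 'b"
    and s'' :: "'k \<Rightarrow> 'c::ab_group_add \<Rightarrow> 'c"
  assumes "vector_space s" "vector_space s'" "vector_space s''"
    and V: "has_dim s V d" and Us: "list_all2 (has_dim s') Us ds"
    and T: "is_tensor_product s s' s'' V Us W t"
  shows "has_dim s'' W (d * prod_list ds)"
proof -
  interpret v: vector_space s by fact
  interpret u: vector_space s' by fact
  interpret w: vector_space s'' by fact
  interpret K: vector_space "(*) :: 'k \<Rightarrow> 'k \<Rightarrow> 'k" by (rule vector_space_field)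
  obtain B where B: "finite B" "v.independent B" "v.span B = V" "card B = d"
    using V unfolding has_dim_def by blast
  have len: "length Us = length ds" using Us by (rule list_all2_lengthD)
  have "\<forall>i<length Us. \<exists>C. finite C \<and> u.independent C \<and> u.span C = Us ! i \<and> card C = ds ! i"
    using list_all2_nthD[OF Us] unfolding has_dim_def by blast
  then obtain C where C: "\<And>i. i < length Us \<Longrightarrow> finite (C i)"
      "\<And>i. i < length Us \<Longrightarrow> u.independent (C i)"
      "\<And>i. i < length Us \<Longrightarrow> u.span (C i) = Us ! i"
      "\<And>i. i < length Us \<Longrightarrow> card (C i) = ds ! i"
    by metis
  let ?m = "length Us"
  define Cs where "Cs = map C [0..<?m]"
  have Cs: "length Cs = ?m" "\<And>i. i < ?m \<Longrightarrow> Cs ! i = C i" by (auto simp: Cs_def)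
  have subV: "v.subspace V" using B by auto
  have subU: "u.subspace U" if U: "U \<in> set Us" for U
    using U C(3) by (metis in_set_conv_nth u.subspace_span)
  have BV: "B \<subseteq> V" using B v.span_superset by auto
  have CU: "C i \<subseteq> Us ! i" if "i < ?m" for i using C(3)[OF that] u.span_superset by auto
  have CsUs: "listset Cs \<subseteq> listset Us" using CU Cs by (fastforce simp: listset_iff_nth)
  have ml: "multilinear_on s s' s'' V Us t"
    by (rule tensor_product_multilinear[OF assms(1-3) subV subU T])
  let ?I = "B \<times> listset Cs"
  let ?e = "\<lambda>(b, bs). t b bs"
  have finI: "finite ?I" unfolding Cs_def by (intro finite_cartesian_product B(1) finite_listset) (auto simp: C(1))
  have W: "W = w.span {t v us | v us. v \<in> V \<and> us \<in> listset Us}"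
    using T unfolding is_tensor_product_def by blast
  \<comment> \<open>Slots \<open>k\<close> and later already hold basis vectors; the induction expands slot \<open>k - 1\<close>, and the base case expands the vector of \<open>V\<close>.\<close>
  have inspan: "t v us \<in> w.span (?e ` ?I)"
    if "k \<le> ?m" "v \<in> V" "us \<in> listset Us" "\<And>i. k \<le> i \<Longrightarrow> i < ?m \<Longrightarrow> us ! i \<in> C i" for k v us
    using that
  proof (induction k arbitrary: us)
    case 0
    then have us: "us \<in> listset Cs" by (auto simp: listset_iff_nth Cs)
    obtain c where c: "v = (\<Sum>b\<in>B. s (c b) b)"
      using v.span_finite[OF B(1)] B(3) 0(2) by auto
    have "linear_on_set s s'' V (\<lambda>v. t v us)" using ml 0 unfolding multilinear_on_def by blast
    from linear_on_set_sum[OF assms(1,3) this subV, of B "\<lambda>b. b" c]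
    have "t v us = (\<Sum>b\<in>B. s'' (c b) (t b us))" using BV c by auto
    moreover have "t b us \<in> w.span (?e ` ?I)" if "b \<in> B" for b
      using us that by (intro w.span_base) force
    ultimately show ?case by (auto intro!: w.span_sum w.span_scale)
  next
    case (Suc k)
    then have k: "k < ?m" by simp
    have uk: "us ! k \<in> Us ! k" using Suc.prems k by (auto simp: listset_iff_nth)
    then obtain c where c: "us ! k = (\<Sum>b\<in>C k. s' (c b) b)"
      using u.span_finite[OF C(1)[OF k]] C(3)[OF k] by auto
    have "linear_on_set s' s'' (Us ! k) (\<lambda>x. t v (us[k := x]))"
      using ml Suc.prems k unfolding multilinear_on_def by blast
    from linear_on_set_sum[OF assms(2,3) this, of "C k" "\<lambda>b. b" c]
    have "t v (us[k := us ! k]) = (\<Sum>b\<in>C k. s'' (c b) (t v (us[k := b])))"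
      using CU[OF k] c subU k by auto
    moreover have "t v (us[k := b]) \<in> w.span (?e ` ?I)" if "b \<in> C k" for b
    proof (rule Suc.IH)
      show "us[k := b] \<in> listset Us" using Suc.prems that CU[OF k] by (auto intro: listset_update)
      show "us[k := b] ! i \<in> C i" if "k \<le> i" "i < ?m" for i
        using that Suc.prems \<open>b \<in> C k\<close> by (cases "i = k") (auto simp: listset_iff_nth)
    qed (use Suc.prems in auto)
    ultimately show ?case by (simp add: w.span_sum w.span_scale)
  qed
  have "has_dim s'' W (card ?I)"
  proof (rule w.has_dim_family[where e = ?e])
    show "w.subspace W" using W by simp
    show "?e i \<in> W" if "i \<in> ?I" for i
      unfolding W using that BV CsUs by (auto intro!: w.span_base)
    show "W \<subseteq> w.span (?e ` ?I)"
      unfolding W by (rule w.span_minimal) (auto intro: inspan[of ?m])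
    show "c x = 0" if 0: "(\<Sum>i\<in>?I. s'' (c i) (?e i)) = 0" and x: "x \<in> ?I" for c x
    proof -
      obtain b0 bs0 where x': "x = (b0, bs0)" "b0 \<in> B" "bs0 \<in> listset Cs" using x by auto
      define f where "f = (\<Sum>i\<in>?I. Poly_Mapping.single i (c i))"
      have look: "Poly_Mapping.lookup f i = (if i \<in> ?I then c i else 0)" for i
        unfolding f_def using finI by (simp add: lookup_sum lookup_single when_def)
      have keys: "Poly_Mapping.keys f \<subseteq> ?I" using look by (auto simp: in_keys_iff split: if_splits)
      have "linear_extension s'' ?e f = 0"
        using 0 by (simp add: w.linear_extension_superset[OF finI keys] look del: mem_Sigma_iff cong: sum.cong)
      moreover have "Poly_Mapping.keys f \<subseteq> V \<times> listset Us" using keys BV CsUs by auto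
      ultimately have fspan: "f \<in> module.span free_scale (tensor_relations s s' V Us)"
        using tensor_product_kernel[OF T] by simp
      \<comment> \<open>The coordinate functional dual to the basis tensor \<open>x\<close>.\<close>
      define g where "g v us = v.representation B v b0 *
        (\<Prod>i<?m. u.representation (C i) (us ! i) (bs0 ! i))" for v us
      have gml: "multilinear_on s s' (*) V Us g"
        unfolding multilinear_on_def
      proof (intro conjI ballI allI impI)
        fix us
        have "v.representation B (v + w) b0 = v.representation B v b0 + v.representation B w b0"
          if "v \<in> V" "w \<in> V" for v w
          using that B(3) v.representation_add[OF B(2)] by auto
        moreover have "v.representation B (s c v) b0 = c * v.representation B v b0"
          if "v \<in> V" for v c
          using that B(3) v.representation_scale[OF B(2)] by auto
        ultimately show "linear_on_set s (*) V (\<lambda>v. g v us)"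
          unfolding linear_on_set_def g_def by (auto simp only: distrib_right mult.assoc)
      next
        fix v us i assume us: "us \<in> listset Us" and i: "i < ?m"
        have "g v (us[i := x]) = v.representation B v b0 * u.representation (C i) x (bs0 ! i) *
           (\<Prod>j\<in>{..<?m} - {i}. u.representation (C j) (us ! j) (bs0 ! j))" for x
        proof -
          have "(\<Prod>j<?m. u.representation (C j) (us[i := x] ! j) (bs0 ! j)) =
             u.representation (C i) x (bs0 ! i) *
             (\<Prod>j\<in>{..<?m} - {i}. u.representation (C j) (us[i := x] ! j) (bs0 ! j))"
            using us i by (subst prod.remove[of _ i]) (auto simp: listset_iff_nth)
          also have "(\<Prod>j\<in>{..<?m} - {i}. u.representation (C j) (us[i := x] ! j) (bs0 ! j)) =
              (\<Prod>j\<in>{..<?m} - {i}. u.representation (C j) (us ! j) (bs0 ! j))"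
            by (rule prod.cong) auto
          finally show ?thesis unfolding g_def by (simp only: mult.assoc)
        qed
        moreover have "u.representation (C i) (x + y) b = u.representation (C i) x b + u.representation (C i) y b"
          if "x \<in> Us ! i" "y \<in> Us ! i" for x y b
          using that C(3)[OF i] u.representation_add[OF C(2)[OF i]] by auto
        moreover have "u.representation (C i) (s' c x) b = c * u.representation (C i) x b"
          if "x \<in> Us ! i" for x c b
          using that C(3)[OF i] u.representation_scale[OF C(2)[OF i]] by auto
        ultimately show "linear_on_set s' (*) (Us ! i) (\<lambda>x. g v (us[i := x]))"
          unfolding linear_on_set_def by (auto simp only: distrib_right distrib_left mult_ac)
      qed
      have "linear_extension (*) (\<lambda>(v, us). g v us) f = 0"
        by (rule K.linear_extension_vanishes_on_span[OF fspan])
           (rule linear_extension_relation[OF vector_space_field gml])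
      then have "(\<Sum>i\<in>?I. c i * (case i of (v, us) \<Rightarrow> g v us)) = 0"
        by (simp add: K.linear_extension_superset[OF finI keys] look del: mem_Sigma_iff cong: sum.cong)
      moreover have "(case i of (v, us) \<Rightarrow> g v us) = (if i = x then 1 else 0)" if i: "i \<in> ?I" for i
      proof -
        obtain b bs where ib: "i = (b, bs)" "b \<in> B" "bs \<in> listset Cs" using i by auto
        have bs: "length bs = ?m" "length bs0 = ?m" "\<And>j. j < ?m \<Longrightarrow> bs ! j \<in> C j"
          using ib(3) x'(3) by (auto simp: listset_iff_nth Cs)
        have g: "g b bs = (if b0 = b then 1 else 0) * (\<Prod>j<?m. if bs0 ! j = bs ! j then 1 else 0)"
          unfolding g_def using B(2) C(2) ib(2) bs
          by (simp add: v.representation_basis u.representation_basis)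
        have "(\<Prod>j<?m. if bs0 ! j = bs ! j then 1 else 0 :: 'k) = (if bs0 = bs then 1 else 0)"
        proof (cases "bs0 = bs")
          case False
          then obtain j where "j < ?m" "bs0 ! j \<noteq> bs ! j" using bs by (metis nth_equalityI)
          then show ?thesis using False by (auto intro!: prod_zero)
        qed simp
        then show ?thesis using g ib x' by auto
      qed
      ultimately have "(\<Sum>i\<in>?I. if i = x then c i else 0) = 0"
        by (simp add: if_distrib del: mem_Sigma_iff cong: sum.cong if_cong)
      then show ?thesis using finI x by (simp add: sum.delta)
    qed
  qed (fact finI)
  moreover have "card ?I = d * prod_list ds"
  proof -
    have "map card Cs = ds" using C(4) len by (intro nth_equalityI) (auto simp: Cs_def)
    then show ?thesis by (simp add: card_cartesian_product card_listset B(4))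
  qed
  ultimately show ?thesis by simp
qed

section \<open>Counting permutations\<close>

lemma group_Sym: "group (Sym n)"
proof (rule groupI)
  fix p assume "p \<in> carrier (Sym n)"
  then show "\<exists>q\<in>carrier (Sym n). q \<otimes>\<^bsub>Sym n\<^esub> p = \<one>\<^bsub>Sym n\<^esub>"
    by (intro bexI[of _ "inv_into UNIV p"]) (auto simp: Sym_def permutes_inv permutes_inv_o)
qed (auto simp: Sym_def permutes_compose o_assoc)

lemma inv_Sym: "p \<in> carrier (Sym n) \<Longrightarrow> inv\<^bsub>Sym n\<^esub> p = inv_into UNIV p"
  by (rule group.inv_equality[OF group_Sym]) (auto simp: Sym_def permutes_inv permutes_inv_o)

lemma order_Sym: "order (Sym n) = fact n"
  by (simp add: order_def Sym_def card_permutations)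

lemma finite_Sym: "finite (carrier (Sym n))"
  by (simp add: Sym_def finite_permutations)

text \<open>
  Both groups that make up \<open>S_lambda ns\<close> have this form: the permutations of the parts that respect
  their sizes, and the permutations of the positions that respect their blocks.
\<close>

definition fibre_perms :: "'a set \<Rightarrow> ('a \<Rightarrow> 'b) \<Rightarrow> ('a \<Rightarrow> 'a) set" where
  "fibre_perms A f = {\<sigma>. \<sigma> permutes A \<and> (\<forall>x\<in>A. f (\<sigma> x) = f x)}"

lemma permutes_restriction:
  assumes "\<sigma> permutes A" "finite B" "B \<subseteq> A" "\<sigma> ` B \<subseteq> B"
  shows "(\<lambda>x. if x \<in> B then \<sigma> x else x) permutes B"
  using assms permutes_inj_on[OF assms(1)]
  by (intro inj_imp_permutes) (auto simp: inj_on_def)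

text \<open>
  Such a permutation restricts to each fibre, and any choice of permutations of the fibres arises.
  The induction splits off the fibre of one value.
\<close>

lemma card_fibre_perms:
  assumes "finite V" "finite A" "f ` A \<subseteq> V"
  shows "card (fibre_perms A f) = (\<Prod>v\<in>V. fact (card {x\<in>A. f x = v}))"
  using assms
proof (induction V arbitrary: A rule: finite_induct)
  case empty
  then show ?case by (simp add: fibre_perms_def)
next
  case (insert v V)
  let ?B = "{x\<in>A. f x = v}" and ?C = "{x\<in>A. f x \<noteq> v}"
  let ?P = "{\<beta>. \<beta> permutes ?B} \<times> fibre_perms ?C f"
  have fin: "finite ?B" "finite ?C" using insert.prems by auto
  have B: "\<beta> x \<in> ?B \<longleftrightarrow> x \<in> ?B" "x \<notin> ?B \<Longrightarrow> \<beta> x = x" if "\<beta> permutes ?B" for \<beta> x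
    using permutes_in_image[OF that, of x] permutes_not_in[OF that, of x] by blast+
  have C: "\<gamma> x \<in> ?C \<longleftrightarrow> x \<in> ?C" "x \<notin> ?C \<Longrightarrow> \<gamma> x = x" "x \<in> ?C \<Longrightarrow> f (\<gamma> x) = f x"
    if "\<gamma> \<in> fibre_perms ?C f" for \<gamma> x
    using that permutes_in_image[of \<gamma> ?C x] permutes_not_in[of \<gamma> ?C x] by (auto simp: fibre_perms_def)
  have onB: "(\<beta> \<circ> \<gamma>) x = \<beta> x" if "\<beta> permutes ?B" "\<gamma> \<in> fibre_perms ?C f" "x \<in> ?B" for \<beta> \<gamma> x
    using C(2)[OF that(2), of x] that(3) by simp
  have onC: "(\<beta> \<circ> \<gamma>) x = \<gamma> x" if "\<beta> permutes ?B" "\<gamma> \<in> fibre_perms ?C f" "x \<in> ?C" for \<beta> \<gamma> x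
    using C(1)[OF that(2), of x] B(2)[OF that(1), of "\<gamma> x"] that(3) by simp
  have "bij_betw (\<lambda>(\<beta>, \<gamma>). \<beta> \<circ> \<gamma>) ?P (fibre_perms A f)"
  proof (rule bij_betw_imageI)
    show "inj_on (\<lambda>(\<beta>, \<gamma>). \<beta> \<circ> \<gamma>) ?P"
    proof (rule inj_onI, clarify, intro conjI ext)
      fix \<beta> \<gamma> \<beta>' \<gamma>' x
      assume h: "\<beta> permutes ?B" "\<gamma> \<in> fibre_perms ?C f" "\<beta>' permutes ?B" "\<gamma>' \<in> fibre_perms ?C f"
        and eq: "\<beta> \<circ> \<gamma> = \<beta>' \<circ> \<gamma>'"
      show "\<beta> x = \<beta>' x"
      proof (cases "x \<in> ?B")
        case True
        show ?thesis using onB[OF h(1,2) True] onB[OF h(3,4) True] eq by simp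
      next
        case False
        show ?thesis using B(2)[OF h(1) False] B(2)[OF h(3) False] by simp
      qed
      show "\<gamma> x = \<gamma>' x"
      proof (cases "x \<in> ?C")
        case True
        show ?thesis using onC[OF h(1,2) True] onC[OF h(3,4) True] eq by simp
      next
        case False
        show ?thesis using C(2)[OF h(2) False] C(2)[OF h(4) False] by simp
      qed
    qed
    show "(\<lambda>(\<beta>, \<gamma>). \<beta> \<circ> \<gamma>) ` ?P = fibre_perms A f"
    proof (intro equalityI subsetI)
      fix \<sigma> assume "\<sigma> \<in> (\<lambda>(\<beta>, \<gamma>). \<beta> \<circ> \<gamma>) ` ?P"
      then obtain \<beta> \<gamma> where h: "\<sigma> = \<beta> \<circ> \<gamma>" "\<beta> permutes ?B" "\<gamma> \<in> fibre_perms ?C f" by auto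
      have "\<beta> permutes A" "\<gamma> permutes A"
        using h(2,3) by (auto simp: fibre_perms_def intro: permutes_subset)
      moreover have "f (\<sigma> x) = f x" if x: "x \<in> A" for x
      proof (cases "x \<in> ?B")
        case True
        then show ?thesis using onB[OF h(2,3) True] B(1)[OF h(2), of x] h(1) by simp
      next
        case False
        then have x: "x \<in> ?C" using x by simp
        show ?thesis using onC[OF h(2,3) x] C(3)[OF h(3) x] h(1) by simp
      qed
      ultimately show "\<sigma> \<in> fibre_perms A f" using h(1) by (simp add: fibre_perms_def permutes_compose)
    next
      fix \<sigma> assume \<sigma>: "\<sigma> \<in> fibre_perms A f"
      then have p: "\<sigma> permutes A" and ff: "\<And>x. x \<in> A \<Longrightarrow> f (\<sigma> x) = f x"
        by (auto simp: fibre_perms_def)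
      have im: "\<sigma> x \<in> A \<longleftrightarrow> x \<in> A" for x by (rule permutes_in_image[OF p])
      define \<beta> where "\<beta> = (\<lambda>x. if x \<in> ?B then \<sigma> x else x)"
      define \<gamma> where "\<gamma> = (\<lambda>x. if x \<in> ?C then \<sigma> x else x)"
      have "\<beta> permutes ?B" unfolding \<beta>_def
        by (rule permutes_restriction[OF p fin(1)]) (use im ff in auto)
      moreover have "\<gamma> permutes ?C" unfolding \<gamma>_def
        by (rule permutes_restriction[OF p fin(2)]) (use im ff in auto)
      then have "\<gamma> \<in> fibre_perms ?C f" using ff by (auto simp: fibre_perms_def \<gamma>_def)
      moreover have "\<sigma> = \<beta> \<circ> \<gamma>"
        using im ff permutes_not_in[OF p] by (auto simp: fun_eq_iff \<beta>_def \<gamma>_def)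
      ultimately show "\<sigma> \<in> (\<lambda>(\<beta>, \<gamma>). \<beta> \<circ> \<gamma>) ` ?P" by force
    qed
  qed
  note bij_betw_same_card[OF this]
  then
  have "card (fibre_perms A f) = fact (card ?B) * card (fibre_perms ?C f)"
    using fin by (simp add: card_cartesian_product card_permutations)
  also have "card (fibre_perms ?C f) = (\<Prod>w\<in>V. fact (card {x\<in>?C. f x = w}))"
    using insert.prems by (intro insert.IH) auto
  also have "\<dots> = (\<Prod>w\<in>V. fact (card {x\<in>A. f x = w}))"
  proof (rule prod.cong)
    fix w assume "w \<in> V"
    then have "{x\<in>?C. f x = w} = {x\<in>A. f x = w}" using insert.hyps by auto
    then show "fact (card {x\<in>?C. f x = w}) = fact (card {x\<in>A. f x = w})" by simp
  qed simp
  finally show ?case using insert.hyps by simp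
qed

lemma part_symmetries_eq: "part_symmetries ns = fibre_perms {..<length ns} ((!) ns)"
  by (auto simp: part_symmetries_def fibre_perms_def)

lemma card_part_symmetries: "card (part_symmetries ns) = (\<Prod>v\<in>set ns. fact (count_list ns v))"
proof -
  have "card {i \<in> {..<length ns}. ns ! i = v} = count_list ns v" for v
    unfolding count_list_eq_length_filter length_filter_conv_card
    by (rule arg_cong[where f = card]) auto
  then show ?thesis
    unfolding part_symmetries_eq by (subst card_fibre_perms[of "set ns"]) auto
qed

section \<open>The stabilizer of a division into blocks\<close>

lemma offset_Suc: "i < length ns \<Longrightarrow> offset ns (Suc i) = offset ns i + ns ! i"
  by (simp add: offset_def take_Suc_conv_app_nth)

lemma offset_mono: "i \<le> j \<Longrightarrow> offset ns i \<le> offset ns j"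
proof (induction rule: dec_induct)
  case (step k)
  then show ?case by (cases "k < length ns") (simp_all add: offset_Suc, simp add: offset_def)
qed simp

text \<open>
  Together with \<open>block_coordinates\<close> this identifies the positions with the pairs of a block and an
  entry of that block.
\<close>

lemma block_of_offset:
  assumes "i < length ns" "k < ns ! i"
  shows "block_of ns (offset ns i + k) = i" "in_block ns (offset ns i + k) = k"
    "offset ns i + k < sum_list ns"
proof -
  show b: "block_of ns (offset ns i + k) = i"
    unfolding block_of_def
  proof (rule Least_equality)
    show "offset ns i + k < offset ns (Suc i)" using assms by (simp add: offset_Suc)
    fix j assume "offset ns i + k < offset ns (Suc j)"
    then show "i \<le> j" using offset_mono[of "Suc j" i ns] by (cases "Suc j \<le> i") auto
  qed
  show "in_block ns (offset ns i + k) = k" unfolding in_block_def b by simp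
  have "offset ns (Suc i) \<le> offset ns (length ns)" using assms by (intro offset_mono) simp
  then show "offset ns i + k < sum_list ns" using assms by (simp add: offset_Suc) (simp add: offset_def)
qed

lemma block_coordinates:
  assumes "p < sum_list ns"
  shows "block_of ns p < length ns" "in_block ns p < ns ! block_of ns p"
    "offset ns (block_of ns p) + in_block ns p = p"
proof -
  let ?i = "block_of ns p"
  have ne: "ns \<noteq> []" using assms by auto
  then have ex: "p < offset ns (Suc (length ns - 1))" using assms by (simp add: offset_def)
  have lt: "p < offset ns (Suc ?i)" unfolding block_of_def using ex by (rule LeastI)
  have "?i \<le> length ns - 1" unfolding block_of_def using ex by (rule Least_le)
  with ne show i: "?i < length ns" by (cases ns) auto
  have le: "offset ns ?i \<le> p"
  proof (cases ?i)
    case 0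
    then show ?thesis by (simp add: offset_def)
  next
    case (Suc j)
    then have "\<not> p < offset ns (Suc j)" unfolding block_of_def by (intro not_less_Least) simp
    then show ?thesis using Suc by simp
  qed
  show "in_block ns p < ns ! ?i" using lt le offset_Suc[OF i] by (simp add: in_block_def)
  show "offset ns ?i + in_block ns p = p" using le by (simp add: in_block_def)
qed

definition Young_subgroup :: "nat list \<Rightarrow> (nat \<Rightarrow> nat) set" where
  "Young_subgroup ns = fibre_perms {..<sum_list ns} (block_of ns)"

lemma card_Young_subgroup: "card (Young_subgroup ns) = prod_list (map fact ns)"
proof -
  have "card {p \<in> {..<sum_list ns}. block_of ns p = i} = ns ! i" if i: "i < length ns" for i
  proof -
    have "{p \<in> {..<sum_list ns}. block_of ns p = i} = (\<lambda>k. offset ns i + k) ` {..<ns ! i}"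
    proof safe
      fix p assume "p < sum_list ns" "i = block_of ns p"
      then show "p \<in> (+) (offset ns (block_of ns p)) ` {..<ns ! block_of ns p}"
        using block_coordinates[of p ns] by (intro image_eqI[of _ _ "in_block ns p"]) auto
    qed (use block_of_offset[OF i] in auto)
    then show ?thesis by (simp add: card_image)
  qed
  then have "card (Young_subgroup ns) = (\<Prod>i<length ns. fact (ns ! i))"
    unfolding Young_subgroup_def
    by (subst card_fibre_perms[of "{..<length ns}"]) (auto simp: block_coordinates)
  also have "\<dots> = prod_list (map fact ns)"
    by (subst prod.list_conv_set_nth) (simp add: atLeast0LessThan)
  finally show ?thesis .
qed

lemma inner_perms_iff:
  "\<tau>s \<in> inner_perms ns \<longleftrightarrow> length \<tau>s = length ns \<and> (\<forall>i<length ns. \<tau>s ! i permutes {..<ns ! i})"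
  by (auto simp: inner_perms_def listset_iff_nth)

lemma sum_perm_coordinates:
  assumes "\<tau>s \<in> inner_perms ns" "p < sum_list ns"
  shows "sum_perm ns \<tau>s p < sum_list ns" "block_of ns (sum_perm ns \<tau>s p) = block_of ns p"
    "in_block ns (sum_perm ns \<tau>s p) = (\<tau>s ! block_of ns p) (in_block ns p)"
proof -
  note c = block_coordinates[OF assms(2)]
  have "(\<tau>s ! block_of ns p) permutes {..<ns ! block_of ns p}"
    using assms(1) c(1) by (simp add: inner_perms_iff)
  from permutes_in_image[OF this] c(2)
  have "(\<tau>s ! block_of ns p) (in_block ns p) < ns ! block_of ns p" by auto
  from block_of_offset[OF c(1) this] assms(2)
  show "sum_perm ns \<tau>s p < sum_list ns" "block_of ns (sum_perm ns \<tau>s p) = block_of ns p"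
    "in_block ns (sum_perm ns \<tau>s p) = (\<tau>s ! block_of ns p) (in_block ns p)"
    by (simp_all add: sum_perm_def)
qed

text \<open>
  A permutation preserving every block is determined by, and may be given by, its effect on the entries
  of each block separately.
\<close>

lemma sum_perm_image: "sum_perm ns ` inner_perms ns = Young_subgroup ns"
proof (intro equalityI subsetI)
  fix p assume "p \<in> sum_perm ns ` inner_perms ns"
  then obtain \<tau>s where p: "p = sum_perm ns \<tau>s" and \<tau>: "\<tau>s \<in> inner_perms ns" by auto
  have "p permutes {..<sum_list ns}"
  proof (rule inj_imp_permutes)
    show "inj_on p {..<sum_list ns}"
    proof (rule inj_onI)
      fix q r assume qr: "q \<in> {..<sum_list ns}" "r \<in> {..<sum_list ns}" "p q = p r"
      have b: "block_of ns q = block_of ns r"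
        using qr sum_perm_coordinates(2)[OF \<tau>] p by (metis lessThan_iff)
      have "(\<tau>s ! block_of ns q) (in_block ns q) = (\<tau>s ! block_of ns q) (in_block ns r)"
        using qr sum_perm_coordinates(3)[OF \<tau>] p b by (metis lessThan_iff)
      moreover have "inj (\<tau>s ! block_of ns q)"
        using \<tau> block_coordinates(1)[of q ns] qr by (auto simp: inner_perms_iff intro: permutes_inj)
      ultimately have "in_block ns q = in_block ns r" by (simp add: inj_eq)
      then show "q = r" using b block_coordinates(3) qr by (metis lessThan_iff)
    qed
  qed (use p sum_perm_coordinates[OF \<tau>] in \<open>auto simp: sum_perm_def\<close>)
  then show "p \<in> Young_subgroup ns"
    using sum_perm_coordinates[OF \<tau>] p by (auto simp: Young_subgroup_def fibre_perms_def)
next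
  fix y assume "y \<in> Young_subgroup ns"
  then have y: "y permutes {..<sum_list ns}" and b: "\<And>p. p < sum_list ns \<Longrightarrow> block_of ns (y p) = block_of ns p"
    by (auto simp: Young_subgroup_def fibre_perms_def)
  have lt: "y p < sum_list ns \<longleftrightarrow> p < sum_list ns" for p using permutes_in_image[OF y, of p] by simp
  define \<tau>s where "\<tau>s = map (\<lambda>i k. if k < ns ! i then in_block ns (y (offset ns i + k)) else k) [0..<length ns]"
  have \<tau>: "(\<tau>s ! i) k = (if k < ns ! i then in_block ns (y (offset ns i + k)) else k)" if "i < length ns" for i k
    using that by (simp add: \<tau>s_def)
  have key: "in_block ns (y (offset ns i + k)) < ns ! i"
      "offset ns i + in_block ns (y (offset ns i + k)) = y (offset ns i + k)"
    if "i < length ns" "k < ns ! i" for i k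
  proof -
    note o = block_of_offset[OF that]
    have "block_of ns (y (offset ns i + k)) = i" using b[OF o(3)] o(1) by simp
    with block_coordinates[of "y (offset ns i + k)" ns] o(3) lt
    show "in_block ns (y (offset ns i + k)) < ns ! i"
      "offset ns i + in_block ns (y (offset ns i + k)) = y (offset ns i + k)" by auto
  qed
  have "\<tau>s ! i permutes {..<ns ! i}" if i: "i < length ns" for i
  proof (rule inj_imp_permutes)
    show "inj_on (\<tau>s ! i) {..<ns ! i}"
    proof (rule inj_onI)
      fix k l assume kl: "k \<in> {..<ns ! i}" "l \<in> {..<ns ! i}" "(\<tau>s ! i) k = (\<tau>s ! i) l"
      then have "in_block ns (y (offset ns i + k)) = in_block ns (y (offset ns i + l))"
        using \<tau>[OF i] by simp
      then have "y (offset ns i + k) = y (offset ns i + l)"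
        using key(2)[OF i, of k] key(2)[OF i, of l] kl by (metis lessThan_iff)
      then show "k = l" using permutes_inj[OF y] by (simp add: inj_eq)
    qed
  qed (use key[OF i] \<tau>[OF i] in auto)
  then have "\<tau>s \<in> inner_perms ns" by (simp add: inner_perms_iff \<tau>s_def)
  moreover have "sum_perm ns \<tau>s p = y p" for p
  proof (cases "p < sum_list ns")
    case True
    note c = block_coordinates[OF True]
    show ?thesis using True \<tau>[OF c(1)] key(2)[OF c(1,2)] c by (simp add: sum_perm_def)
  next
    case False
    then show ?thesis using permutes_not_in[OF y] by (simp add: sum_perm_def)
  qed
  then have "sum_perm ns \<tau>s = y" ..
  ultimately show "y \<in> sum_perm ns ` inner_perms ns" by blast
qed

text \<open>
  Since block permutations in \<open>S_lambda ns\<close> only exchange blocks of equal size, the rearranged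
  composition in the definition of \<open>block_perm\<close> is \<open>ns\<close> itself.
\<close>

lemma permute_list_part_symmetry:
  "\<sigma> \<in> part_symmetries ns \<Longrightarrow> permute_list \<sigma> ns = ns"
  by (intro nth_equalityI) (auto simp: part_symmetries_def permute_list_def)

lemma part_symmetries_nat:
  assumes "\<sigma> \<in> part_symmetries ns" "i < length ns"
  shows "\<sigma> i < length ns" "ns ! \<sigma> i = ns ! i"
  using assms permutes_in_image[of \<sigma> "{..<length ns}" i] by (auto simp: part_symmetries_def)

lemma block_perm_coordinates:
  assumes "\<sigma> \<in> part_symmetries ns" "p < sum_list ns"
  shows "block_perm ns \<sigma> p < sum_list ns" "block_of ns (block_perm ns \<sigma> p) = \<sigma> (block_of ns p)"
    "in_block ns (block_perm ns \<sigma> p) = in_block ns p"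
proof -
  note c = block_coordinates[OF assms(2)]
  note s = part_symmetries_nat[OF assms(1) c(1)]
  have "in_block ns p < ns ! \<sigma> (block_of ns p)" using c(2) s(2) by simp
  from block_of_offset[OF s(1) this] assms(2)
  show "block_perm ns \<sigma> p < sum_list ns" "block_of ns (block_perm ns \<sigma> p) = \<sigma> (block_of ns p)"
    "in_block ns (block_perm ns \<sigma> p) = in_block ns p"
    by (simp_all add: block_perm_def permute_list_part_symmetry[OF assms(1)])
qed

lemma block_perm_permutes:
  assumes "\<sigma> \<in> part_symmetries ns"
  shows "block_perm ns \<sigma> permutes {..<sum_list ns}"
proof (rule inj_imp_permutes)
  show "inj_on (block_perm ns \<sigma>) {..<sum_list ns}"
  proof (rule inj_onI)
    fix q r assume qr: "q \<in> {..<sum_list ns}" "r \<in> {..<sum_list ns}" "block_perm ns \<sigma> q = block_perm ns \<sigma> r"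
    have "\<sigma> (block_of ns q) = \<sigma> (block_of ns r)" "in_block ns q = in_block ns r"
      using qr block_perm_coordinates[OF assms] by (metis lessThan_iff)+
    moreover have "inj \<sigma>" using assms by (auto simp: part_symmetries_def intro: permutes_inj)
    ultimately show "q = r" using block_coordinates(3) qr by (metis injD lessThan_iff)
  qed
qed (use block_perm_coordinates[OF assms] in \<open>auto simp: block_perm_def\<close>)

lemma id_part_symmetries: "id \<in> part_symmetries ns"
  by (simp add: part_symmetries_def permutes_id)

lemma comp_part_symmetries:
  assumes "\<sigma> \<in> part_symmetries ns" "\<rho> \<in> part_symmetries ns"
  shows "\<sigma> \<circ> \<rho> \<in> part_symmetries ns"
proof -
  have "ns ! (\<sigma> \<circ> \<rho>) i = ns ! i" if "i < length ns" for i
    using part_symmetries_nat[OF assms(2) that] part_symmetries_nat(2)[OF assms(1)] by simp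
  then show ?thesis using assms by (simp add: part_symmetries_def permutes_compose)
qed

lemma inv_part_symmetries:
  assumes "\<sigma> \<in> part_symmetries ns"
  shows "inv_into UNIV \<sigma> \<in> part_symmetries ns"
proof -
  have p: "\<sigma> permutes {..<length ns}" using assms by (simp add: part_symmetries_def)
  have "ns ! inv_into UNIV \<sigma> i = ns ! i" if "i < length ns" for i
  proof -
    have "inv_into UNIV \<sigma> i < length ns" using permutes_in_image[OF permutes_inv[OF p], of i] that by simp
    from part_symmetries_nat(2)[OF assms this] show ?thesis using permutes_inverses(1)[OF p] by simp
  qed
  then show ?thesis using permutes_inv[OF p] by (simp add: part_symmetries_def)
qed

definition block_stabilizer :: "nat list \<Rightarrow> (nat \<Rightarrow> nat) set" where
  "block_stabilizer ns = {p. p permutes {..<sum_list ns} \<and>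
     (\<exists>\<sigma>\<in>part_symmetries ns. \<forall>q<sum_list ns. block_of ns (p q) = \<sigma> (block_of ns q))}"

lemma subgroup_block_stabilizer: "subgroup (block_stabilizer ns) (Sym (sum_list ns))"
proof (rule group.subgroupI[OF group_Sym])
  show "block_stabilizer ns \<subseteq> carrier (Sym (sum_list ns))"
    by (auto simp: block_stabilizer_def Sym_def)
  have "id \<in> block_stabilizer ns"
    unfolding block_stabilizer_def
    by (intro CollectI conjI bexI[of _ id] id_part_symmetries) simp_all
  then show "block_stabilizer ns \<noteq> {}" by blast
next
  fix p assume p: "p \<in> block_stabilizer ns"
  then obtain \<sigma> where \<sigma>: "\<sigma> \<in> part_symmetries ns" "\<And>q. q < sum_list ns \<Longrightarrow> block_of ns (p q) = \<sigma> (block_of ns q)"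
    and pp: "p permutes {..<sum_list ns}"
    by (auto simp: block_stabilizer_def)
  have s: "\<sigma> permutes {..<length ns}" using \<sigma>(1) by (simp add: part_symmetries_def)
  have "block_of ns (inv_into UNIV p q) = inv_into UNIV \<sigma> (block_of ns q)" if "q < sum_list ns" for q
  proof -
    have "inv_into UNIV p q < sum_list ns"
      using permutes_in_image[OF permutes_inv[OF pp], of q] that by simp
    from \<sigma>(2)[OF this] show ?thesis
      using permutes_inverses(1)[OF pp] permutes_inverses(2)[OF s] by simp
  qed
  then have "inv_into UNIV p \<in> block_stabilizer ns"
    using permutes_inv[OF pp] inv_part_symmetries[OF \<sigma>(1)] by (auto simp: block_stabilizer_def)
  then show "inv\<^bsub>Sym (sum_list ns)\<^esub> p \<in> block_stabilizer ns"
    using inv_Sym[of p "sum_list ns"] pp by (simp add: Sym_def)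
next
  fix p p' assume "p \<in> block_stabilizer ns" "p' \<in> block_stabilizer ns"
  then obtain \<sigma> \<sigma>' where \<sigma>: "\<sigma> \<in> part_symmetries ns" "\<And>q. q < sum_list ns \<Longrightarrow> block_of ns (p q) = \<sigma> (block_of ns q)"
    and \<sigma>': "\<sigma>' \<in> part_symmetries ns" "\<And>q. q < sum_list ns \<Longrightarrow> block_of ns (p' q) = \<sigma>' (block_of ns q)"
    and pp: "p permutes {..<sum_list ns}" "p' permutes {..<sum_list ns}"
    by (auto simp: block_stabilizer_def)
  have "block_of ns ((p \<circ> p') q) = (\<sigma> \<circ> \<sigma>') (block_of ns q)" if "q < sum_list ns" for q
    using \<sigma>(2)[of "p' q"] \<sigma>'(2)[OF that] permutes_in_image[OF pp(2), of q] that by simp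
  then show "p \<otimes>\<^bsub>Sym (sum_list ns)\<^esub> p' \<in> block_stabilizer ns"
    using permutes_compose[OF pp(2,1)] bexI[OF _ comp_part_symmetries[OF \<sigma>(1) \<sigma>'(1)]]
    by (simp add: block_stabilizer_def Sym_def)
qed

lemma Young_subset_stabilizer: "Young_subgroup ns \<subseteq> block_stabilizer ns"
proof
  fix y assume "y \<in> Young_subgroup ns"
  then show "y \<in> block_stabilizer ns"
    unfolding block_stabilizer_def Young_subgroup_def fibre_perms_def
    by (intro CollectI conjI bexI[of _ id] id_part_symmetries) simp_all
qed

lemma block_perm_in_stabilizer: "\<sigma> \<in> part_symmetries ns \<Longrightarrow> block_perm ns \<sigma> \<in> block_stabilizer ns"
  using block_perm_permutes block_perm_coordinates(2) unfolding block_stabilizer_def by blast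

text \<open>
  If a permutation moves the blocks in the same way as \<open>block_perm ns \<sigma>\<close> does, then undoing the latter
  leaves a permutation that maps every block to itself.
\<close>

lemma block_stabilizer_factorization:
  "block_stabilizer ns = (\<lambda>(\<sigma>, y). block_perm ns \<sigma> \<circ> y) ` (part_symmetries ns \<times> Young_subgroup ns)"
proof (intro equalityI subsetI)
  fix p assume "p \<in> (\<lambda>(\<sigma>, y). block_perm ns \<sigma> \<circ> y) ` (part_symmetries ns \<times> Young_subgroup ns)"
  then obtain \<sigma> y where "p = block_perm ns \<sigma> \<circ> y" "\<sigma> \<in> part_symmetries ns" "y \<in> Young_subgroup ns"
    by auto
  then show "p \<in> block_stabilizer ns"
    using subgroup.m_closed[OF subgroup_block_stabilizer block_perm_in_stabilizer, of \<sigma> ns y]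
      Young_subset_stabilizer
    by (auto simp: Sym_def)
next
  fix p assume "p \<in> block_stabilizer ns"
  then obtain \<sigma> where \<sigma>: "\<sigma> \<in> part_symmetries ns" "\<And>q. q < sum_list ns \<Longrightarrow> block_of ns (p q) = \<sigma> (block_of ns q)"
    and pp: "p permutes {..<sum_list ns}"
    by (auto simp: block_stabilizer_def)
  have s: "\<sigma> permutes {..<length ns}" using \<sigma>(1) by (simp add: part_symmetries_def)
  note bp = block_perm_permutes[OF \<sigma>(1)]
  define y where "y = inv_into UNIV (block_perm ns \<sigma>) \<circ> p"
  have y: "y permutes {..<sum_list ns}"
    unfolding y_def by (intro permutes_compose pp permutes_inv bp)
  have p: "p = block_perm ns \<sigma> \<circ> y"
    unfolding y_def by (simp add: o_assoc permutes_inv_o(1)[OF bp])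
  have "block_of ns (y q) = block_of ns q" if q: "q < sum_list ns" for q
  proof -
    have "y q < sum_list ns" using permutes_in_image[OF y, of q] q by simp
    from block_perm_coordinates(2)[OF \<sigma>(1) this]
    have "\<sigma> (block_of ns (y q)) = \<sigma> (block_of ns q)" using \<sigma>(2)[OF q] p by simp
    then show ?thesis using permutes_inj[OF s] by (simp add: inj_eq)
  qed
  then have "y \<in> Young_subgroup ns" using y by (simp add: Young_subgroup_def fibre_perms_def)
  then have "(\<sigma>, y) \<in> part_symmetries ns \<times> Young_subgroup ns" using \<sigma>(1) by simp
  then show "p \<in> (\<lambda>(\<sigma>, y). block_perm ns \<sigma> \<circ> y) ` (part_symmetries ns \<times> Young_subgroup ns)"
    by (rule rev_image_eqI) (simp add: p)
qed

text \<open>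
  The stabilizer is a subgroup containing the generators, and the factorization writes each of its
  elements as a product of two generators.
\<close>

lemma S_lambda_eq_stabilizer: "S_lambda ns = block_stabilizer ns"
proof
  have "sum_perm ns ` inner_perms ns \<union> block_perm ns ` part_symmetries ns \<subseteq> block_stabilizer ns"
    using Young_subset_stabilizer block_perm_in_stabilizer by (auto simp: sum_perm_image)
  then show "S_lambda ns \<subseteq> block_stabilizer ns"
    unfolding S_lambda_def by (rule group.generate_subgroup_incl[OF group_Sym _ subgroup_block_stabilizer])
  show "block_stabilizer ns \<subseteq> S_lambda ns"
  proof
    fix p assume "p \<in> block_stabilizer ns"
    then obtain \<sigma> y where "\<sigma> \<in> part_symmetries ns" "y \<in> Young_subgroup ns" and p: "p = block_perm ns \<sigma> \<circ> y"
      unfolding block_stabilizer_factorization by auto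
    then have "block_perm ns \<sigma> \<otimes>\<^bsub>Sym (sum_list ns)\<^esub> y \<in> S_lambda ns"
      unfolding S_lambda_def by (intro generate.eng generate.incl) (auto simp: sum_perm_image)
    then show "p \<in> S_lambda ns" using p by (simp add: Sym_def)
  qed
qed

text \<open>
  The factors of an element of the stabilizer are unique: \<open>\<sigma>\<close> is visible in the movement of the blocks,
  provided that no block is empty, since empty blocks can be exchanged without moving any position.
\<close>

lemma card_S_lambda:
  assumes "0 \<notin> set ns"
  shows "card (S_lambda ns) = card (part_symmetries ns) * prod_list (map fact ns)"
proof -
  let ?f = "\<lambda>(\<sigma>, y). block_perm ns \<sigma> \<circ> y"
  have "inj_on ?f (part_symmetries ns \<times> Young_subgroup ns)"
  proof (rule inj_onI, clarify)
    fix \<sigma> y \<sigma>' y'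
    assume h: "\<sigma> \<in> part_symmetries ns" "\<sigma>' \<in> part_symmetries ns" "y \<in> Young_subgroup ns" "y' \<in> Young_subgroup ns"
      and eq: "block_perm ns \<sigma> \<circ> y = block_perm ns \<sigma>' \<circ> y'"
    have Y: "z q < sum_list ns" "block_of ns (z q) = block_of ns q"
      if "z \<in> Young_subgroup ns" "q < sum_list ns" for z q
      using that permutes_in_image[of z "{..<sum_list ns}" q] by (auto simp: Young_subgroup_def fibre_perms_def)
    have "\<sigma> i = \<sigma>' i" for i
    proof (cases "i < length ns")
      case True
      then have "0 < ns ! i" using assms by (metis gr0I nth_mem)
      \<comment> \<open>The value \<open>\<sigma> i\<close> is read off at the first position of block \<open>i\<close>.\<close>
      note o = block_of_offset[OF True this]
      have "block_of ns ((block_perm ns \<sigma> \<circ> y) (offset ns i + 0)) = \<sigma> i"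
        using block_perm_coordinates(2)[OF h(1) Y(1)[OF h(3) o(3)]] Y(2)[OF h(3) o(3)] o(1) by simp
      moreover have "block_of ns ((block_perm ns \<sigma>' \<circ> y') (offset ns i + 0)) = \<sigma>' i"
        using block_perm_coordinates(2)[OF h(2) Y(1)[OF h(4) o(3)]] Y(2)[OF h(4) o(3)] o(1) by simp
      ultimately show ?thesis using eq by simp
    next
      case False
      then have "i \<notin> {..<length ns}" by simp
      moreover have "\<sigma> permutes {..<length ns}" "\<sigma>' permutes {..<length ns}"
        using h(1,2) by (simp_all add: part_symmetries_def)
      ultimately show ?thesis by (metis permutes_not_in)
    qed
    then have \<sigma>: "\<sigma> = \<sigma>'" ..
    moreover have "y = y'"
    proof
      fix q
      have "block_perm ns \<sigma> (y q) = block_perm ns \<sigma> (y' q)" using fun_cong[OF eq, of q] \<sigma> by simp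
      then show "y q = y' q" using permutes_inj[OF block_perm_permutes[OF h(1)]] by (simp add: inj_eq)
    qed
    ultimately show "\<sigma> = \<sigma>' \<and> y = y'" by simp
  qed
  then show ?thesis
    unfolding S_lambda_eq_stabilizer block_stabilizer_factorization
    by (simp add: card_image card_cartesian_product card_Young_subgroup)
qed

lemma card_lcosets_S_lambda:
  assumes "0 \<notin> set ns"
  shows "card (lcosets\<^bsub>Sym (sum_list ns)\<^esub> (S_lambda ns)) =
    fact (sum_list ns) div ((\<Prod>v\<in>set ns. fact (count_list ns v)) * prod_list (map fact ns))"
proof -
  have "card (lcosets\<^bsub>Sym (sum_list ns)\<^esub> (S_lambda ns)) * card (S_lambda ns) = fact (sum_list ns)"
    using group.l_lagrange[OF group_Sym finite_Sym subgroup_block_stabilizer]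
    by (simp add: order_Sym S_lambda_eq_stabilizer)
  moreover have "card (S_lambda ns) > 0"
    using calculation by (metis fact_nonzero gr0I mult_0_right)
  ultimately show ?thesis
    unfolding card_S_lambda[OF assms] card_part_symmetries by (metis nonzero_mult_div_cancel_right less_numeral_extra(3))
qed

section \<open>Dimension of an induced module\<close>

lemma linear_on_set_subset: "linear_on_set s s' V f \<Longrightarrow> W \<subseteq> V \<Longrightarrow> linear_on_set s s' W f"
  unfolding linear_on_set_def by blast

lemma Sym_module_inj_on:
  assumes "Sym_module s n V act" "g \<in> carrier (Sym n)"
  shows "inj_on (act g) V"
proof (rule inj_on_inverseI)
  fix v assume v: "v \<in> V"
  have p: "g permutes {..<n}" using assms(2) by (simp add: Sym_def)
  then have "inv_into UNIV g \<in> carrier (Sym n)" by (simp add: Sym_def permutes_inv)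
  then have "act (inv_into UNIV g) (act g v) = act (inv_into UNIV g \<circ> g) v"
    using assms v unfolding Sym_module_def by metis
  also have "\<dots> = v" using assms(1) v permutes_inv_o(2)[OF p] by (simp add: Sym_module_def)
  finally show "act (inv_into UNIV g) (act g v) = v" .
qed

lemma finite_lcosets_Sym: "subgroup H (Sym n) \<Longrightarrow> finite (lcosets\<^bsub>Sym n\<^esub> H)"
  using group.lcosets_subset_PowG[OF group_Sym] finite_Sym by (metis finite_Pow_iff finite_subset)

lemma subgroup_in_lcosets: "H \<in> lcosets\<^bsub>Sym n\<^esub> H"
proof -
  have "\<one>\<^bsub>Sym n\<^esub> <#\<^bsub>Sym n\<^esub> H = H" by (auto simp: l_coset_def Sym_def)
  moreover have "\<one>\<^bsub>Sym n\<^esub> \<in> carrier (Sym n)" by (simp add: Sym_def permutes_id)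
  ultimately show ?thesis unfolding LCOSETS_def by blast
qed

text \<open>
  Elements of one coset differ by elements of \<open>H\<close>, which keep \<open>W\<close> inside itself, so they all produce
  the same translate.
\<close>

lemma translate_eq_image:
  assumes "Sym_module s n X act" "W \<subseteq> X" "\<And>h. h \<in> H \<Longrightarrow> act h ` W \<subseteq> W"
    and H: "subgroup H (Sym n)" and g: "g \<in> carrier (Sym n)"
  shows "{act g' w | g' w. g' \<in> g <#\<^bsub>Sym n\<^esub> H \<and> w \<in> W} = act g ` W"
proof -
  have mult: "act (g \<circ> h) w = act g (act h w)" if "h \<in> H" "w \<in> W" for h w
    using assms(1,2) g that subgroup.subset[OF H] unfolding Sym_module_def by blast
  have coset: "g <#\<^bsub>Sym n\<^esub> H = {g \<circ> h | h. h \<in> H}" by (auto simp: l_coset_def Sym_def)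
  have id: "id \<in> H" using subgroup.one_closed[OF H] by (simp add: Sym_def)
  show ?thesis
  proof (intro equalityI subsetI)
    fix x assume "x \<in> {act g' w | g' w. g' \<in> g <#\<^bsub>Sym n\<^esub> H \<and> w \<in> W}"
    then obtain h w where "h \<in> H" "w \<in> W" "x = act (g \<circ> h) w" unfolding coset by auto
    moreover from this have "act h w \<in> W" using assms(3) by blast
    ultimately show "x \<in> act g ` W" using mult by auto
  next
    fix x assume "x \<in> act g ` W"
    then obtain w where w: "w \<in> W" "x = act g w" by auto
    moreover have "g \<in> g <#\<^bsub>Sym n\<^esub> H" unfolding coset using id by (auto intro!: exI[of _ id])
    ultimately show "x \<in> {act g' w | g' w. g' \<in> g <#\<^bsub>Sym n\<^esub> H \<and> w \<in> W}" by blast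
  qed
qed

lemma has_dim_induced:
  assumes "vector_space s" and X: "Sym_module s n X act" and WX: "W \<subseteq> X"
    and H: "subgroup H (Sym n)" and ind: "is_induced n act H W M" and W: "has_dim s W d"
  shows "has_dim s M (card (lcosets\<^bsub>Sym n\<^esub> H) * d)"
proof -
  interpret vector_space s by fact
  have "has_dim s {act g w | g w. g \<in> C \<and> w \<in> W} d" if C: "C \<in> lcosets\<^bsub>Sym n\<^esub> H" for C
  proof -
    obtain g where g: "g \<in> carrier (Sym n)" "C = g <#\<^bsub>Sym n\<^esub> H"
      using C by (auto simp: LCOSETS_def)
    have "has_dim s (act g ` W) d"
    proof (rule has_dim_linear_image[OF assms(1,1) _ _ W])
      show "linear_on_set s s W (act g)"
        using X g(1) WX unfolding Sym_module_def by (blast intro: linear_on_set_subset)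
      show "inj_on (act g) W" using Sym_module_inj_on[OF X g(1)] WX by (rule inj_on_subset)
    qed
    then show ?thesis
      using translate_eq_image[OF X WX _ H g(1)] ind g(2) by (simp add: is_induced_def)
  qed
  moreover have "direct_sum_on (lcosets\<^bsub>Sym n\<^esub> H) (\<lambda>C. {act g w | g w. g \<in> C \<and> w \<in> W}) M"
    using ind by (simp add: is_induced_def)
  ultimately have "has_dim s M (\<Sum>C\<in>lcosets\<^bsub>Sym n\<^esub> H. d)"
    by (intro has_dim_direct_sum[OF finite_lcosets_Sym[OF H]])
  then show ?thesis by simp
qed

section \<open>Modules assembled from partitions\<close>

lemma length_le_sum_list: "0 \<notin> set ns \<Longrightarrow> length ns \<le> sum_list (ns :: nat list)"
  by (induction ns) auto

lemma part_le: "0 \<notin> set ns \<Longrightarrow> k \<in> set ns \<Longrightarrow> k + (length ns - 1) \<le> sum_list (ns :: nat list)"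
proof (induction ns)
  case (Cons a ns)
  then show ?case using length_le_sum_list[of ns] by (cases "ns") auto
qed simp

lemma partitions_bounds:
  assumes "ns \<in> partitions n"
  shows "sum_list ns = n" "0 \<notin> set ns" "1 \<le> length ns" "length ns \<le> n"
    "\<And>k. k \<in> set ns \<Longrightarrow> 1 \<le> k \<and> k < n"
proof -
  show *: "sum_list ns = n" "0 \<notin> set ns" "1 \<le> length ns"
    using assms by (auto simp: partitions_def)
  then show "length ns \<le> n" using length_le_sum_list[of ns] by simp
  have "2 \<le> length ns" using assms by (simp add: partitions_def)
  then show "1 \<le> k \<and> k < n" if "k \<in> set ns" for k
    using part_le[OF *(2) that] that * by (cases k) auto
qed

lemma finite_partitions: "finite (partitions n)"
proof (rule finite_subset)
  show "partitions n \<subseteq> {ns. set ns \<subseteq> {..<Suc n} \<and> length ns \<le> n}"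
    using partitions_bounds by (fastforce simp: less_Suc_eq)
qed (simp add: finite_lists_length_le)

lemma subgroup_S_lambda: "sum_list ns = n \<Longrightarrow> subgroup (S_lambda ns) (Sym n)"
  using subgroup_block_stabilizer[of ns] by (simp add: S_lambda_eq_stabilizer)

lemma sum_perm_id: "sum_perm ns (replicate (length ns) id) = id"
  by (rule ext) (simp add: sum_perm_def block_coordinates)

text \<open>
  The division is exact: the quotient is the index of \<open>S_lambda ns\<close> in \<open>S_n\<close>, since
  \<open>count_list ns v\<close> is the number of blocks of size \<open>v\<close>.
\<close>

definition root_count :: "(nat \<Rightarrow> nat) \<Rightarrow> (nat \<Rightarrow> nat) \<Rightarrow> nat \<Rightarrow> nat" where
  "root_count p u n =
    (\<Sum>ns\<in>partitions n. fact n div ((\<Prod>v\<in>set ns. fact (count_list ns v)) * prod_list (map fact ns))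
       * (p (length ns) * prod_list (map u ns)))"

text \<open>
  The group is known to act linearly and invertibly on \<open>X\<close> only, so the tensor products \<open>W ns\<close> have to be
  located inside \<open>X\<close> before their translates can be measured.  A pure tensor is fixed by the identity
  permutation, because the identity is a product of identities inside the blocks.  It therefore lies in
  the translate belonging to the trivial coset, which is a summand of a summand of \<open>X\<close>.
\<close>

theorem has_dim_root_sum:
  fixes T :: "('k::field, 'c::ab_group_add) bicolored" and P :: "('k, 'a::ab_group_add) operad"
  assumes sP: "vector_space (scl P)" and sT: "vector_space (tscl T)"
    and X: "Sym_module (tscl T) n X (tact T n)"
    and U: "\<And>k. 1 \<le> k \<Longrightarrow> k < n \<Longrightarrow> Sym_module (tscl T) k (U k) (tact T k)"
    and dU: "\<And>k. 1 \<le> k \<Longrightarrow> k < n \<Longrightarrow> has_dim (tscl T) (U k) (u k)"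
    and dP: "\<And>m. 1 \<le> m \<Longrightarrow> m \<le> n \<Longrightarrow> has_dim (scl P) (component P m) (p m)"
    and root: "root_sum T P U n X"
  shows "has_dim (tscl T) X (root_count p u n)"
proof -
  interpret vector_space "tscl T" by fact
  obtain M W t where sum: "direct_sum_on (partitions n) M X"
    and ind: "\<And>ns. ns \<in> partitions n \<Longrightarrow> is_induced n (tact T n) (S_lambda ns) (W ns) (M ns)"
    and tens: "\<And>ns. ns \<in> partitions n \<Longrightarrow>
           is_tensor_product (scl P) (tscl T) (tscl T) (component P (length ns)) (map U ns)
             (W ns) (t ns)"
    and act: "\<And>ns a us \<tau>s. ns \<in> partitions n \<Longrightarrow> a \<in> component P (length ns) \<Longrightarrow>
           us \<in> listset (map U ns) \<Longrightarrow> \<tau>s \<in> inner_perms ns \<Longrightarrow>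
              tact T n (sum_perm ns \<tau>s) (t ns a us)
              = t ns a (map (\<lambda>i. tact T (ns ! i) (\<tau>s ! i) (us ! i)) [0..<length ns])"
    using root unfolding root_sum_def by (elim exE conjE) (rule that, blast+)
  have sX: "subspace X" using X by (simp add: Sym_module_def)
  have H: "subgroup (S_lambda ns) (Sym n)" if "ns \<in> partitions n" for ns
    using partitions_bounds(1)[OF that] by (rule subgroup_S_lambda)
  have dW: "has_dim (tscl T) (W ns) (p (length ns) * prod_list (map u ns))" if ns: "ns \<in> partitions n" for ns
  proof (rule has_dim_tensor_product[OF sP sT sT _ _ tens[OF ns]])
    show "has_dim (scl P) (component P (length ns)) (p (length ns))"
      using partitions_bounds[OF ns] by (intro dP) auto
    show "list_all2 (has_dim (tscl T)) (map U ns) (map u ns)"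
      using partitions_bounds(5)[OF ns] dU by (auto simp: list_all2_conv_all_nth)
  qed
  have W0: "0 \<in> W ns" if "ns \<in> partitions n" for ns
    using has_dim_subspace[OF dW[OF that]] by (rule subspace_0)
  let ?E = "\<lambda>ns C. {tact T n g w | g w. g \<in> C \<and> w \<in> W ns}"
  have E0: "0 \<in> ?E ns C" if ns: "ns \<in> partitions n" and C: "C \<in> lcosets\<^bsub>Sym n\<^esub> (S_lambda ns)" for ns C
  proof -
    obtain g where g: "g \<in> carrier (Sym n)" "C = g <#\<^bsub>Sym n\<^esub> S_lambda ns"
      using C by (auto simp: LCOSETS_def)
    have "g \<in> C" using group.lcos_self[OF group_Sym g(1) H[OF ns]] g(2) by simp
    moreover have "tact T n g 0 = 0"
      using X g(1) by (intro linear_on_set_zero[OF sT sT _ sX]) (auto simp: Sym_module_def)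
    ultimately show ?thesis using W0[OF ns] by force
  qed
  have sumM: "direct_sum_on (lcosets\<^bsub>Sym n\<^esub> (S_lambda ns)) (?E ns) (M ns)" if "ns \<in> partitions n" for ns
    using ind[OF that] by (simp add: is_induced_def)
  have EM: "?E ns (S_lambda ns) \<subseteq> M ns" if ns: "ns \<in> partitions n" for ns
    by (rule direct_sum_on_summand_subset[OF finite_lcosets_Sym[OF H[OF ns]] sumM[OF ns] E0[OF ns]])
      (assumption, rule subgroup_in_lcosets)
  have idH: "id \<in> S_lambda ns" if "ns \<in> partitions n" for ns
    using subgroup.one_closed[OF H[OF that]] by (simp add: Sym_def)
  have MX: "M ns \<subseteq> X" if ns: "ns \<in> partitions n" for ns
  proof (rule direct_sum_on_summand_subset[OF finite_partitions sum _ ns])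
    fix ms assume ms: "ms \<in> partitions n"
    from E0[OF ms subgroup_in_lcosets] show "0 \<in> M ms" using EM[OF ms] by blast
  qed
  have WX: "W ns \<subseteq> X" if ns: "ns \<in> partitions n" for ns
  proof -
    have W: "W ns = span {t ns v us | v us. v \<in> component P (length ns) \<and> us \<in> listset (map U ns)}"
      using tens[OF ns] unfolding is_tensor_product_def by blast
    have "t ns a us \<in> X" if a: "a \<in> component P (length ns)" and us: "us \<in> listset (map U ns)" for a us
    proof -
      let ?ids = "replicate (length ns) (id :: nat \<Rightarrow> nat)"
      have "?ids \<in> inner_perms ns" by (simp add: inner_perms_iff)
      from act[OF ns a us this]
      have "tact T n id (t ns a us) = t ns a (map (\<lambda>i. tact T (ns ! i) (?ids ! i) (us ! i)) [0..<length ns])"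
        by (simp add: sum_perm_id)
      also have "map (\<lambda>i. tact T (ns ! i) (?ids ! i) (us ! i)) [0..<length ns] = us"
      proof (rule nth_equalityI)
        fix i assume "i < length (map (\<lambda>i. tact T (ns ! i) (?ids ! i) (us ! i)) [0..<length ns])"
        then have i: "i < length ns" by simp
        then have "us ! i \<in> U (ns ! i)" using us by (simp add: listset_iff_nth)
        then show "map (\<lambda>i. tact T (ns ! i) (?ids ! i) (us ! i)) [0..<length ns] ! i = us ! i"
          using U[of "ns ! i"] partitions_bounds(5)[OF ns, of "ns ! i"] i by (simp add: Sym_module_def)
      qed (use us in \<open>simp add: listset_iff_nth\<close>)
      finally have fixed: "tact T n id (t ns a us) = t ns a us" .
      have "t ns a us \<in> W ns" unfolding W using a us by (intro span_base) blast
      then have "t ns a us \<in> ?E ns (S_lambda ns)" using idH[OF ns] fixed by force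
      then show ?thesis using EM[OF ns] MX[OF ns] by blast
    qed
    then show ?thesis unfolding W by (intro span_minimal sX) auto
  qed
  have "has_dim (tscl T) (M ns)
      (fact n div ((\<Prod>v\<in>set ns. fact (count_list ns v)) * prod_list (map fact ns))
       * (p (length ns) * prod_list (map u ns)))" if ns: "ns \<in> partitions n" for ns
    using has_dim_induced[OF sT X WX[OF ns] H[OF ns] ind[OF ns] dW[OF ns]]
      card_lcosets_S_lambda[OF partitions_bounds(2)[OF ns]] partitions_bounds(1)[OF ns]
    by simp
  from has_dim_direct_sum[OF finite_partitions sum this] show ?thesis by (simp add: root_count_def)
qed

section \<open>The partitions of 3, 4 and 5\<close>

text \<open>
  Partitions of \<open>n\<close> with all parts at most the first argument; the recursion decides whether a part
  equal to this bound occurs.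
\<close>

fun bounded_partitions :: "nat \<Rightarrow> nat \<Rightarrow> nat list list" where
  "bounded_partitions 0 n = (if n = 0 then [[]] else [])"
| "bounded_partitions (Suc k) n =
     bounded_partitions k n @ (if Suc k \<le> n then map ((#) (Suc k)) (bounded_partitions (Suc k) (n - Suc k)) else [])"

lemma set_bounded_partitions:
  "set (bounded_partitions k n) =
     {ns. sorted_wrt (\<ge>) ns \<and> 0 \<notin> set ns \<and> sum_list ns = n \<and> (\<forall>x\<in>set ns. x \<le> k)}"
proof (induction k n rule: bounded_partitions.induct)
  case (1 n)
  have "sorted_wrt (\<ge>) ns \<and> 0 \<notin> set ns \<and> sum_list ns = n \<and> (\<forall>x\<in>set ns. x \<le> 0)
      \<longleftrightarrow> ns = [] \<and> n = 0" for ns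
    by (cases ns) auto
  then show ?case by simp
next
  case (2 k n)
  let ?D = "\<lambda>k n. {ns. sorted_wrt (\<ge>) ns \<and> 0 \<notin> set ns \<and> sum_list ns = n \<and> (\<forall>x\<in>set ns. x \<le> k)}"
  \<comment> \<open>A part \<open>Suc k\<close> is the largest possible one, so in a decreasing list it comes first.\<close>
  have "?D (Suc k) n = ?D k n \<union> (if Suc k \<le> n then (#) (Suc k) ` ?D (Suc k) (n - Suc k) else {})" (is "?L = ?R")
  proof (intro equalityI subsetI)
    fix ns assume ns: "ns \<in> ?L"
    show "ns \<in> ?R"
    proof (cases "\<forall>x\<in>set ns. x \<le> k")
      case False
      then obtain x where x: "x \<in> set ns" "k < x" by (auto simp: not_le)
      then obtain a as where a: "ns = a # as" by (cases ns) auto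
      have "x \<le> a" using ns x(1) unfolding a by auto
      moreover have "a \<le> Suc k" using ns unfolding a by simp
      ultimately have "a = Suc k" using x(2) by simp
      then show ?thesis using ns unfolding a by auto
    qed (use ns in simp)
  next
    fix ns assume "ns \<in> ?R"
    then consider "ns \<in> ?D k n" | as where "Suc k \<le> n" "as \<in> ?D (Suc k) (n - Suc k)" "ns = Suc k # as"
      by (auto split: if_splits)
    then show "ns \<in> ?L" by cases auto
  qed
  moreover have "set (bounded_partitions (Suc k) n) = set (bounded_partitions k n) \<union>
      (if Suc k \<le> n then (#) (Suc k) ` set (bounded_partitions (Suc k) (n - Suc k)) else {})"
    by (subst bounded_partitions.simps(2)) (simp del: bounded_partitions.simps)
  ultimately show ?case using 2 by (cases "Suc k \<le> n") (simp_all only: if_True if_False)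
qed

lemma partitions_eq_bounded_partitions:
  "partitions n = set (filter (\<lambda>ns. 2 \<le> length ns) (bounded_partitions n n))"
proof -
  have "x \<le> n" if "sum_list ns = n" "x \<in> set ns" for x and ns :: "nat list"
    using that member_le_sum_list by blast
  then show ?thesis unfolding set_filter set_bounded_partitions partitions_def by auto
qed

lemma partitions_3: "partitions 3 = {[2, 1], [1, 1, 1]}"
  unfolding partitions_eq_bounded_partitions by (simp add: eval_nat_numeral) auto

lemma partitions_4: "partitions 4 = {[3, 1], [2, 2], [2, 1, 1], [1, 1, 1, 1]}"
  unfolding partitions_eq_bounded_partitions by (simp add: eval_nat_numeral) auto

lemma partitions_5:
  "partitions 5 = {[4, 1], [3, 2], [3, 1, 1], [2, 2, 1], [2, 1, 1, 1], [1, 1, 1, 1, 1]}"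
  unfolding partitions_eq_bounded_partitions by (simp add: eval_nat_numeral) auto

lemma root_count_3: "u 1 = 1 \<Longrightarrow> root_count p u 3 = p 3 + 3 * p 2 * u 2"
  unfolding root_count_def partitions_3 by (simp add: fact_numeral flip: numeral_2_eq_2)

lemma root_count_4:
  "u 1 = 1 \<Longrightarrow> root_count p u 4 = p 4 + 6 * p 3 * u 2 + 3 * p 2 * (u 2)\<^sup>2 + 4 * p 2 * u 3"
  unfolding root_count_def partitions_4 by (simp add: fact_numeral power2_eq_square flip: numeral_2_eq_2)

lemma root_count_5:
  "u 1 = 1 \<Longrightarrow> root_count p u 5 = p 5 + 10 * p 4 * u 2 + 15 * p 3 * (u 2)\<^sup>2
     + 10 * p 3 * u 3 + 10 * p 2 * u 2 * u 3 + 5 * p 2 * u 4"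
  unfolding root_count_def partitions_5 by (simp add: fact_numeral power2_eq_square flip: numeral_2_eq_2)

section \<open>Dimensions of the free product\<close>

lemma has_dim_component:
  assumes "symmetric_operad P" "finite_dim_comps P" "1 \<le> m"
  shows "has_dim (scl P) (component P m) (vector_space.dim (scl P) (component P m))"
proof -
  interpret vector_space "scl P" using assms(1) by (rule symmetric_operad.ambient)
  show ?thesis using assms(2,3) has_dim_span_finite unfolding finite_dim_comps_def by blast
qed

context free_product_modules
begin

lemma Sym_module_black: "1 \<le> n \<Longrightarrow> Sym_module (tscl T) n (black T n) (tact T n)"
  using t_module[of n] t_black[of n] t_one by (cases "n = 1") auto

lemma Sym_module_white: "1 \<le> n \<Longrightarrow> Sym_module (tscl T) n (white T n) (tact T n)"
  using t_module[of n] t_white[of n] t_one by (cases "n = 1") auto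

lemma has_dim_one: "has_dim (tscl T) (whole T 1) 1"
proof -
  interpret vector_space "tscl T" by (rule t_ambient)
  have "independent {tident T}" using t_one by simp
  then show ?thesis unfolding has_dim_def t_one by (intro exI[of _ "{tident T}"]) simp
qed

end

lemma has_dim_Sym_isomorphic:
  assumes "vector_space s" "vector_space s'" "Sym_isomorphic s s' n V act V' act'" "has_dim s V d"
  shows "has_dim s' V' d"
proof -
  obtain \<phi> where "bij_betw \<phi> V V'" "linear_on_set s s' V \<phi>"
    using assms(3) unfolding Sym_isomorphic_def by blast
  then show ?thesis
    using has_dim_linear_image[OF assms(1,2) _ _ assms(4), of \<phi>] by (simp add: bij_betw_def)
qed

text \<open>
  The recursion for one colour needs finite bases for the other colour in all smaller arities, so
  finite-dimensionality of both is proved by one induction; the recursion for the dimensions follows.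
\<close>

theorem free_product_dimensions:
  assumes P: "symmetric_operad P" "finite_dim_comps P" and Q: "symmetric_operad Q" "finite_dim_comps Q"
    and T: "free_product_modules P Q T"
  defines "p \<equiv> \<lambda>m. vector_space.dim (scl P) (component P m)"
    and "q \<equiv> \<lambda>m. vector_space.dim (scl Q) (component Q m)"
    and "b \<equiv> \<lambda>n. vector_space.dim (tscl T) (black T n)"
    and "w \<equiv> \<lambda>n. vector_space.dim (tscl T) (white T n)"
  shows "b 1 = 1" "w 1 = 1" "b 2 = p 2" "w 2 = q 2"
    "\<And>n. 2 < n \<Longrightarrow> b n = root_count p w n" "\<And>n. 2 < n \<Longrightarrow> w n = root_count q b n"
proof -
  interpret free_product_modules P Q T by fact
  interpret vector_space "tscl T" by (rule t_ambient)
  note sP = symmetric_operad.ambient[OF P(1)] and sQ = symmetric_operad.ambient[OF Q(1)]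
  have dP: "has_dim (scl P) (component P m) (p m)" if "1 \<le> m" for m
    unfolding p_def by (rule has_dim_component[OF P that])
  have dQ: "has_dim (scl Q) (component Q m) (q m)" if "1 \<le> m" for m
    unfolding q_def by (rule has_dim_component[OF Q that])
  have 1: "has_dim (tscl T) (black T 1) 1" "has_dim (tscl T) (white T 1) 1"
    using has_dim_one t_one by simp_all
  have 2: "has_dim (tscl T) (black T 2) (p 2)" "has_dim (tscl T) (white T 2) (q 2)"
    using has_dim_Sym_isomorphic[OF sP t_ambient t_two_black dP]
      has_dim_Sym_isomorphic[OF sQ t_ambient t_two_white dQ] by simp_all
  have step: "has_dim (tscl T) (black T n) (root_count p w n)"
      "has_dim (tscl T) (white T n) (root_count q b n)"
    if n: "2 < n" and IH: "\<And>k. 1 \<le> k \<Longrightarrow> k < n \<Longrightarrow>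
        has_dim (tscl T) (black T k) (b k) \<and> has_dim (tscl T) (white T k) (w k)" for n
  proof -
    show "has_dim (tscl T) (black T n) (root_count p w n)"
      by (rule has_dim_root_sum[OF sP t_ambient _ _ _ _ t_black_step[OF n]])
        (use n IH in \<open>auto intro: Sym_module_black Sym_module_white dP\<close>)
    show "has_dim (tscl T) (white T n) (root_count q b n)"
      by (rule has_dim_root_sum[OF sQ t_ambient _ _ _ _ t_white_step[OF n]])
        (use n IH in \<open>auto intro: Sym_module_black Sym_module_white dQ\<close>)
  qed
  have dims: "has_dim (tscl T) (black T n) (b n) \<and> has_dim (tscl T) (white T n) (w n)" if "1 \<le> n" for n
    using that
  proof (induction n rule: less_induct)
    case (less n)
    consider "n = 1" | "n = 2" | "2 < n" using less.prems by linarith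
    then have "\<exists>d. has_dim (tscl T) (black T n) d" "\<exists>d. has_dim (tscl T) (white T n) d"
      using 1 2 step[OF _ less.IH] by (cases; blast)+
    then show ?case unfolding b_def w_def using has_dim_dim by blast
  qed
  show "b 1 = 1" "w 1 = 1" "b 2 = p 2" "w 2 = q 2"
    unfolding b_def w_def using 1 2 by (simp_all add: has_dim_dim)
  show "b n = root_count p w n" "w n = root_count q b n" if "2 < n" for n
    using step[OF that dims] unfolding b_def w_def by (simp_all add: has_dim_dim)
qed

theorem corollary1:
  fixes O1 :: "('k::field, 'a::ab_group_add) operad"
    and O2 :: "('k, 'b::ab_group_add) operad"
    and T :: "('k, 'c::ab_group_add) bicolored"
    and x y d_black d_white :: "nat \<Rightarrow> nat"
  assumes "symmetric_operad O1" and "binary O1" and "finite_dim_comps O1"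
    and "symmetric_operad O2" and "binary O2" and "finite_dim_comps O2"
    and "free_product_modules O1 O2 T"
    and "\<And>m. x m = vector_space.dim (scl O1) (component O1 m)"
    and "\<And>m. y m = vector_space.dim (scl O2) (component O2 m)"
    and "\<And>n. d_black n = vector_space.dim (tscl T) (black T n)"
    and "\<And>n. d_white n = vector_space.dim (tscl T) (white T n)"
  shows "d_black 3 = x 3 + 3 * x 2 * y 2
     \<and> d_black 4 = x 4 + 6 * x 3 * y 2 + 3 * x 2 * (y 2)^2 + 4 * x 2 * y 3
           + 12 * (x 2)^2 * y 2
     \<and> d_black 5 = x 5 + 10 * x 4 * y 2 + 5 * x 2 * y 4 + 15 * x 3 * (y 2)^2
           + 30 * (x 2)^2 * y 3 + 50 * x 2 * x 3 * y 2 + 10 * x 2 * y 2 * y 3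
           + 90 * (x 2)^2 * (y 2)^2 + 15 * (x 2)^3 * y 2 + 10 * x 3 * y 3
     \<and> d_white 3 = y 3 + 3 * y 2 * x 2
     \<and> d_white 4 = y 4 + 6 * y 3 * x 2 + 3 * y 2 * (x 2)^2 + 4 * y 2 * x 3
           + 12 * (y 2)^2 * x 2
     \<and> d_white 5 = y 5 + 10 * y 4 * x 2 + 5 * y 2 * x 4 + 15 * y 3 * (x 2)^2
           + 30 * (y 2)^2 * x 3 + 50 * y 2 * y 3 * x 2 + 10 * y 2 * x 2 * x 3
           + 90 * (y 2)^2 * (x 2)^2 + 15 * (y 2)^3 * x 2 + 10 * y 3 * x 3"
proof -
  have eqs: "d_black = (\<lambda>n. vector_space.dim (tscl T) (black T n))"
    "d_white = (\<lambda>n. vector_space.dim (tscl T) (white T n))"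
    "x = (\<lambda>m. vector_space.dim (scl O1) (component O1 m))"
    "y = (\<lambda>m. vector_space.dim (scl O2) (component O2 m))"
    using assms(8-11) by auto
  have dims: "d_black 1 = 1" "d_white 1 = 1" "d_black 2 = x 2" "d_white 2 = y 2"
    "\<And>n. 2 < n \<Longrightarrow> d_black n = root_count x d_white n"
    "\<And>n. 2 < n \<Longrightarrow> d_white n = root_count y d_black n"
    unfolding eqs by (fact free_product_dimensions[OF assms(1,3,4,6,7)])+
  have 3: "d_black 3 = x 3 + 3 * x 2 * y 2" "d_white 3 = y 3 + 3 * y 2 * x 2"
    using dims(5,6)[of 3] root_count_3[of d_white x, OF dims(2)]
      root_count_3[of d_black y, OF dims(1)] dims(3,4) by simp_all
  have 4: "d_black 4 = x 4 + 6 * x 3 * y 2 + 3 * x 2 * (y 2)\<^sup>2 + 4 * x 2 * d_white 3"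
    "d_white 4 = y 4 + 6 * y 3 * x 2 + 3 * y 2 * (x 2)\<^sup>2 + 4 * y 2 * d_black 3"
    using dims(5,6)[of 4] root_count_4[of d_white x, OF dims(2)]
      root_count_4[of d_black y, OF dims(1)] dims(3,4) by simp_all
  have 5: "d_black 5 = x 5 + 10 * x 4 * y 2 + 15 * x 3 * (y 2)\<^sup>2 + 10 * x 3 * d_white 3
       + 10 * x 2 * y 2 * d_white 3 + 5 * x 2 * d_white 4"
    "d_white 5 = y 5 + 10 * y 4 * x 2 + 15 * y 3 * (x 2)\<^sup>2 + 10 * y 3 * d_black 3
       + 10 * y 2 * x 2 * d_black 3 + 5 * y 2 * d_black 4"
    using dims(5,6)[of 5] root_count_5[of d_white x, OF dims(2)]
      root_count_5[of d_black y, OF dims(1)] dims(3,4) by simp_all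
  show ?thesis
    unfolding 5 4 3 by (simp add: algebra_simps power2_eq_square power3_eq_cube)
qed

end
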